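(* Let $\Gamma_1,\dots,\Gamma_k$ be graphs with $d$ vertices (loops and multiple edges allowed) and let $W_1\le S_d,\dots,W_k\le S_d$ be their automorphism groups, respectively. Suppose that $W_1$ is the dihedral group of order $2b$, where $b$ is an odd natural number, and let $\delta\colon W_1\to K$ be the nontrivial one-dimensional character of $W_1$. Then the number of all superpositions of $\Gamma_1,\dots,\Gamma_k$ which have an automorphism group of odd order is $$ N\bigl(Z(\delta;p_1,\dots,p_d)\ast Z(1_{W_2};p_1,\dots,p_d)\ast\cdots\ast Z(1_{W_k};p_1,\dots,p_d)\bigr). $$
   Context: $K$ is an algebraically closed field of characteristic zero; $d,k\ge1$; $S_d$ is the symmetric group; a one-dimensional character of a group $W$ is a homomorphism $W\to K^*$; $1_W$ is the trivial character. "Dihedral" refers to $W_1$ as an abstract group. The graphs have vertex set $\{1,\dots,d\}$, and the automorphism group of a graph is the group of vertex permutations preserving edge multiplicities. Superpositions of $\Gamma_1,\dots,\Gamma_k$ are the ways of placing the graphs on a common set of $d$ vertices, up to simultaneous relabelling of the vertices; that is, the equivalence classes of tuples $(a_1,\dots,a_k)\in S_d\times\cdots\times S_d$ (where $a_m$ represents the placed copy $a_m\Gamma_m$) under $(a_1,\dots,a_k)\sim(b_1,\dots,b_k)$ iff there are $\zeta\in S_d$ and $w_m\in W_m$ with $b_m=\zeta a_mw_m$ for all $m$. The automorphism group of the superposition represented by $(a_1,\dots,a_k)$ is $a_1W_1a_1^{-1}\cap\cdots\cap a_kW_ka_k^{-1}$ (well defined up to conjugation in $S_d$). For $W\le S_d$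 and a one-dimensional character $\chi$ of $W$, $Z(\chi;p_1,\dots,p_d)=|W|^{-1}\sum_{\sigma\in W}\chi(\sigma)p_1^{c_1(\sigma)}\cdots p_d^{c_d(\sigma)}$, where $c_s(\sigma)$ is the number of cycles of length $s$ of $\sigma$ and $p_s=\sum_{i\ge0}x_i^s$ are the power sums in $x_0,x_1,\dots$. With $R^d$ the group of generalized characters of $S_d$, $\Lambda^d$ the group of homogeneous degree $d$ symmetric functions with integer coefficients in $x_0,x_1,\dots$, and $ch\colon R^d\to\Lambda^d$ the (bijective) characteristic map $ch(u)=\frac1{d!}\sum_{\sigma\in S_d}u(\sigma)p_1^{c_1(\sigma)}\cdots p_d^{c_d(\sigma)}$, one has $Z(\chi;p_1,\dots,p_d)=ch(\mathrm{ind}_W^{S_d}(\chi))$, and the internal product on $\Lambda^d$ is defined by $ch(u)\ast ch(v)=ch(uv)$. For a polynomial $A$ in $p_1,\dots,p_d$, $N(A)$ is the sum of its coefficients. *)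

theory Defs
  imports
    "HOL-Library.Uprod"
    "HOL-Library.Multiset"
    "HOL-Library.Poly_Mapping"
    "HOL-Combinatorics.Orbits"
    "HOL-Computational_Algebra.Polynomial"
    "HOL-Algebra.Sym_Groups"
    "HOL-Algebra.Elementary_Groups"
    "Jordan_Normal_Form.Matrix"
begin

section \<open>Formal power series in the variables \<open>x\<^sub>0, x\<^sub>1, \<dots>\<close>\<close>

text \<open>
  Symmetric functions in infinitely many variables are realised as formal power series: a series
  assigns a coefficient to every monomial, and the monomial with exponents \<open>m\<close> is the finitely
  supported function \<open>m :: nat \<Rightarrow>\<^sub>0 nat\<close>.
\<close>

typedef 'a mseries = "UNIV :: ((nat \<Rightarrow>\<^sub>0 nat) \<Rightarrow> 'a) set"
  morphisms mcoeff Abs_mseries ..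

setup_lifting type_definition_mseries

lemma mseries_eqI: "(\<And>m. mcoeff f m = mcoeff g m) \<Longrightarrow> f = g"
  by (metis mcoeff_inject ext)

definition msplit :: "(nat \<Rightarrow>\<^sub>0 nat) \<Rightarrow> ((nat \<Rightarrow>\<^sub>0 nat) \<times> (nat \<Rightarrow>\<^sub>0 nat)) set" where
  "msplit m = {(a, b). a + b = m}"

lemma finite_monomial_divisors: "finite {a :: nat \<Rightarrow>\<^sub>0 nat. \<exists>b. a + b = m}" (is "finite ?D")
proof (rule inj_on_finite)
  let ?r = "\<lambda>a. restrict (Poly_Mapping.lookup a) (Poly_Mapping.keys m)"
  have sub: "Poly_Mapping.keys a \<subseteq> Poly_Mapping.keys m" if "a \<in> ?D" for a
    using that by (auto simp: in_keys_iff lookup_add)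
  show "inj_on ?r ?D"
  proof (rule inj_onI)
    fix a a' assume a: "a \<in> ?D" "a' \<in> ?D" and eq: "?r a = ?r a'"
    show "a = a'"
    proof (rule poly_mapping_eqI)
      fix k
      show "Poly_Mapping.lookup a k = Poly_Mapping.lookup a' k"
      proof (cases "k \<in> Poly_Mapping.keys m")
        case True
        then show ?thesis using fun_cong[OF eq, of k] by simp
      next
        case False
        then have "k \<notin> Poly_Mapping.keys a" "k \<notin> Poly_Mapping.keys a'" using sub a by blast+
        then show ?thesis by (simp add: in_keys_iff)
      qed
    qed
  qed
  show "?r ` ?D \<subseteq> (\<Pi>\<^sub>E k\<in>Poly_Mapping.keys m. {..Poly_Mapping.lookup m k})"
    by (auto simp: lookup_add)
  show "finite (\<Pi>\<^sub>E k\<in>Poly_Mapping.keys m. {..Poly_Mapping.lookup m k})"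
    by (intro finite_PiE) auto
qed

lemma finite_msplit [simp]: "finite (msplit m)"
proof (rule finite_subset)
  show "msplit m \<subseteq> {a. \<exists>b. a + b = m} \<times> {a. \<exists>b. a + b = m}"
    by (auto simp: msplit_def) (metis add.commute)
qed (simp add: finite_monomial_divisors)

instantiation mseries :: (comm_ring_1) comm_ring_1
begin

lift_definition zero_mseries :: "'a mseries" is "\<lambda>m. 0" .
lift_definition one_mseries :: "'a mseries" is "\<lambda>m. if m = 0 then 1 else 0" .
lift_definition plus_mseries :: "'a mseries \<Rightarrow> 'a mseries \<Rightarrow> 'a mseries"
  is "\<lambda>f g m. f m + g m" .
lift_definition uminus_mseries :: "'a mseries \<Rightarrow> 'a mseries" is "\<lambda>f m. - f m" .
lift_definition minus_mseries :: "'a mseries \<Rightarrow> 'a mseries \<Rightarrow> 'a mseries"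
  is "\<lambda>f g m. f m - g m" .
lift_definition times_mseries :: "'a mseries \<Rightarrow> 'a mseries \<Rightarrow> 'a mseries"
  is "\<lambda>f g m. \<Sum>(a, b)\<in>msplit m. f a * g b" .

instance
proof
  fix f g h :: "'a mseries"
  show "f * g * h = f * (g * h)"
  proof (rule mseries_eqI)
    fix m
    have "mcoeff (f * g * h) m =
        (\<Sum>(e, c)\<in>msplit m. \<Sum>(a, b)\<in>msplit e. mcoeff f a * mcoeff g b * mcoeff h c)"
      by (simp add: times_mseries.rep_eq sum_distrib_right case_prod_unfold)
    also have "\<dots> = (\<Sum>((e, c), (a, b))\<in>(SIGMA (e, c):msplit m. msplit e).
        mcoeff f a * mcoeff g b * mcoeff h c)"
      by (subst sum.Sigma [symmetric]) (auto simp: case_prod_unfold)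
    also have "\<dots> = (\<Sum>((a, e), (b, c))\<in>(SIGMA (a, e):msplit m. msplit e).
        mcoeff f a * mcoeff g b * mcoeff h c)"
      by (rule sum.reindex_bij_witness[where
            i = "\<lambda>((a, e), (b, c)). ((a + b, c), (a, b))" and
            j = "\<lambda>((e, c), (a, b)). ((a, b + c), (b, c))"])
        (auto simp: msplit_def add.assoc)
    also have "\<dots> = (\<Sum>(a, e)\<in>msplit m. \<Sum>(b, c)\<in>msplit e. mcoeff f a * mcoeff g b * mcoeff h c)"
      by (subst sum.Sigma [symmetric]) (auto simp: case_prod_unfold)
    also have "\<dots> = mcoeff (f * (g * h)) m"
      by (simp add: times_mseries.rep_eq sum_distrib_left case_prod_unfold mult.assoc)
    finally show "mcoeff (f * g * h) m = mcoeff (f * (g * h)) m" .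
  qed
  show "f * g = g * f"
  proof (rule mseries_eqI)
    fix m
    show "mcoeff (f * g) m = mcoeff (g * f) m"
      unfolding times_mseries.rep_eq
      by (rule sum.reindex_bij_witness[where i = prod.swap and j = prod.swap])
        (auto simp: msplit_def add.commute mult.commute)
  qed
  show "1 * f = f"
  proof (rule mseries_eqI)
    fix m
    have "mcoeff (1 * f) m = (\<Sum>(a, b)\<in>msplit m. (if a = 0 then 1 else 0) * mcoeff f b)"
      by (simp add: times_mseries.rep_eq one_mseries.rep_eq)
    also have "\<dots> = (\<Sum>(a, b)\<in>{(0 :: nat \<Rightarrow>\<^sub>0 nat, m)}. (if a = 0 then 1 else 0) * mcoeff f b)"
      by (rule sum.mono_neutral_right[OF finite_msplit]) (auto simp: msplit_def split: if_splits)
    finally show "mcoeff (1 * f) m = mcoeff f m" by simp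
  qed
  show "(f + g) * h = f * h + g * h"
    by (rule mseries_eqI)
      (simp add: times_mseries.rep_eq plus_mseries.rep_eq case_prod_unfold distrib_right sum.distrib)
  show "(0 :: 'a mseries) \<noteq> 1"
    by transfer (auto simp: fun_eq_iff)
qed (transfer; simp add: add.assoc add.commute fun_eq_iff)+

end

lift_definition mscale :: "'a::comm_ring_1 \<Rightarrow> 'a mseries \<Rightarrow> 'a mseries"
  is "\<lambda>c f m. c * f m" .

text \<open>For \<open>s \<ge> 1\<close>, the power sum \<open>p\<^sub>s = \<Sum>i\<ge>0. x\<^sub>i ^ s\<close>.\<close>

lift_definition power_sum :: "nat \<Rightarrow> 'a::comm_ring_1 mseries"
  is "\<lambda>s m. if \<exists>i. m = Poly_Mapping.single i s then 1 else 0" .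


section \<open>Polynomials in the power sums\<close>

text \<open>
  A polynomial in indeterminates \<open>t\<^sub>1, \<dots>, t\<^sub>d\<close> is a finitely supported map
  \<open>P :: (nat \<Rightarrow>\<^sub>0 nat) \<Rightarrow>\<^sub>0 'a\<close> all of whose monomials are supported in \<open>{1..d}\<close>.
\<close>

definition poly_vars_in :: "nat set \<Rightarrow> ((nat \<Rightarrow>\<^sub>0 nat) \<Rightarrow>\<^sub>0 'a::zero) \<Rightarrow> bool" where
  "poly_vars_in V P \<longleftrightarrow> (\<forall>m\<in>Poly_Mapping.keys P. Poly_Mapping.keys m \<subseteq> V)"

definition eval_power_sums :: "nat \<Rightarrow> ((nat \<Rightarrow>\<^sub>0 nat) \<Rightarrow>\<^sub>0 'a::comm_ring_1) \<Rightarrow> 'a mseries" where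
  "eval_power_sums d P = (\<Sum>m\<in>Poly_Mapping.keys P.
     mscale (Poly_Mapping.lookup P m) (\<Prod>s=1..d. power_sum s ^ Poly_Mapping.lookup m s))"

definition sum_of_coeffs :: "((nat \<Rightarrow>\<^sub>0 nat) \<Rightarrow>\<^sub>0 'a::comm_ring_1) \<Rightarrow> 'a" where
  "sum_of_coeffs P = (\<Sum>m\<in>Poly_Mapping.keys P. Poly_Mapping.lookup P m)"

text \<open>
  The polynomial chosen here is unique in characteristic zero, because \<open>p\<^sub>1, \<dots>, p\<^sub>d\<close> are then
  algebraically independent.
\<close>

definition N :: "nat \<Rightarrow> 'a::comm_ring_1 mseries \<Rightarrow> 'a" where
  "N d A = sum_of_coeffs (SOME P. poly_vars_in {1..d} P \<and> eval_power_sums d P = A)"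


section \<open>Characters, the characteristic map and the internal product\<close>

text \<open>
  A subgroup \<open>W\<close> of \<open>S\<^sub>d\<close> is given by its set of elements.
\<close>

abbreviation perm_subgroup :: "nat \<Rightarrow> (nat \<Rightarrow> nat) set \<Rightarrow> (nat \<Rightarrow> nat) monoid" where
  "perm_subgroup d W \<equiv> (sym_group d)\<lparr>carrier := W\<rparr>"

definition field_units :: "'a::field monoid" where
  "field_units = \<lparr>carrier = {x. x \<noteq> 0}, monoid.mult = (*), one = 1\<rparr>"

definition one_dim_character :: "nat \<Rightarrow> (nat \<Rightarrow> nat) set \<Rightarrow> ((nat \<Rightarrow> nat) \<Rightarrow> 'a::field) \<Rightarrow> bool" where
  "one_dim_character d W \<chi> \<longleftrightarrow> \<chi> \<in> hom (perm_subgroup d W) field_units"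

text \<open>Fixed points are counted as cycles of length 1.\<close>

definition cycle_count :: "nat \<Rightarrow> nat \<Rightarrow> (nat \<Rightarrow> nat) \<Rightarrow> nat" where
  "cycle_count d s \<sigma> = card {C \<in> Orbits.orbit \<sigma> ` {1..d}. card C = s}"

definition cycle_monomial :: "nat \<Rightarrow> (nat \<Rightarrow> nat) \<Rightarrow> 'a::comm_ring_1 mseries" where
  "cycle_monomial d \<sigma> = (\<Prod>s=1..d. power_sum s ^ cycle_count d s \<sigma>)"

definition cycle_index :: "nat \<Rightarrow> (nat \<Rightarrow> nat) set \<Rightarrow> ((nat \<Rightarrow> nat) \<Rightarrow> 'a::field) \<Rightarrow> 'a mseries" where
  "cycle_index d W \<chi> =
     mscale (inverse (of_nat (card W))) (\<Sum>\<sigma>\<in>W. mscale (\<chi> \<sigma>) (cycle_monomial d \<sigma>))"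

definition mat_trace :: "'a::comm_ring_1 mat \<Rightarrow> 'a" where
  "mat_trace A = (\<Sum>i<dim_row A. A $$ (i, i))"

text \<open>
  Matrix representations of degree \<open>n\<close> are homomorphisms to \<open>GL\<^sub>n\<close>, the unit group of the matrix
  ring.  Class functions on \<open>S\<^sub>d\<close> are set to 0 outside \<open>S\<^sub>d\<close>, so that the characteristic map can be
  injective on them.
\<close>

definition sym_characters :: "nat \<Rightarrow> ((nat \<Rightarrow> nat) \<Rightarrow> 'a::field) set" where
  "sym_characters d =
     {\<lambda>\<sigma>. if \<sigma> \<in> carrier (sym_group d) then mat_trace (\<rho> \<sigma>) else 0 | \<rho> n.
        \<rho> \<in> hom (sym_group d) (units_of (ring_mat TYPE('a) n ()))}"

definition generalized_characters :: "nat \<Rightarrow> ((nat \<Rightarrow> nat) \<Rightarrow> 'a::field) set" where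
  "generalized_characters d =
     {\<lambda>\<sigma>. u \<sigma> - v \<sigma> | u v. u \<in> sym_characters d \<and> v \<in> sym_characters d}"

definition ch :: "nat \<Rightarrow> ((nat \<Rightarrow> nat) \<Rightarrow> 'a::field) \<Rightarrow> 'a mseries" where
  "ch d u = mscale (inverse (of_nat (fact d)))
     (\<Sum>\<sigma>\<in>carrier (sym_group d). mscale (u \<sigma>) (cycle_monomial d \<sigma>))"

text \<open>
  In characteristic zero, \<open>ch d\<close> is a bijection from the generalized characters of \<open>S\<^sub>d\<close> onto the
  homogeneous symmetric functions of degree \<open>d\<close> with integer coefficients, so the product below is
  the one determined by \<open>ch u * ch v = ch (u v)\<close> on these symmetric functions.
\<close>

definition ch_inv :: "nat \<Rightarrow> 'a::field mseries \<Rightarrow> (nat \<Rightarrow> nat) \<Rightarrow> 'a" where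
  "ch_inv d = inv_into (generalized_characters d) (ch d)"

definition internal_prod :: "nat \<Rightarrow> 'a::field mseries \<Rightarrow> 'a mseries \<Rightarrow> 'a mseries" where
  "internal_prod d A B = ch d (\<lambda>\<sigma>. ch_inv d A \<sigma> * ch_inv d B \<sigma>)"


section \<open>Graphs and superpositions\<close>

text \<open>
  A graph is the multiset of its edges, which are unordered pairs of vertices (an edge
  \<^term>\<open>Upair v v\<close> is a loop).
\<close>

definition graph_on :: "nat \<Rightarrow> nat uprod multiset \<Rightarrow> bool" where
  "graph_on d \<Gamma> \<longleftrightarrow> (\<forall>e. e \<in># \<Gamma> \<longrightarrow> set_uprod e \<subseteq> {1..d})"

definition graph_aut :: "nat \<Rightarrow> nat uprod multiset \<Rightarrow> (nat \<Rightarrow> nat) set" where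
  "graph_aut d \<Gamma> = {\<sigma> \<in> carrier (sym_group d).
     \<forall>i\<in>{1..d}. \<forall>j\<in>{1..d}. count \<Gamma> (Upair (\<sigma> i) (\<sigma> j)) = count \<Gamma> (Upair i j)}"

text \<open>
  \<open>W\<close> assigns to each index in \<open>{1..k}\<close> a subgroup of \<open>S\<^sub>d\<close>; the tuples \<open>(a\<^sub>1, \<dots>, a\<^sub>k)\<close> are the
  extensional functions on \<open>{1..k}\<close>.
\<close>

definition placements :: "nat \<Rightarrow> nat \<Rightarrow> (nat \<Rightarrow> nat \<Rightarrow> nat) set" where
  "placements d k = (\<Pi>\<^sub>E m\<in>{1..k}. carrier (sym_group d))"

definition placement_rel ::
  "nat \<Rightarrow> nat \<Rightarrow> (nat \<Rightarrow> (nat \<Rightarrow> nat) set) \<Rightarrow> ((nat \<Rightarrow> nat \<Rightarrow> nat) \<times> (nat \<Rightarrow> nat \<Rightarrow> nat)) set" where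
  "placement_rel d k W = {(a, b). a \<in> placements d k \<and> b \<in> placements d k \<and>
     (\<exists>\<zeta>\<in>carrier (sym_group d). \<forall>m\<in>{1..k}. \<exists>w\<in>W m. b m = \<zeta> \<circ> a m \<circ> w)}"

definition superpositions ::
  "nat \<Rightarrow> nat \<Rightarrow> (nat \<Rightarrow> (nat \<Rightarrow> nat) set) \<Rightarrow> (nat \<Rightarrow> nat \<Rightarrow> nat) set set" where
  "superpositions d k W = placements d k // placement_rel d k W"

definition placement_aut ::
  "nat \<Rightarrow> (nat \<Rightarrow> (nat \<Rightarrow> nat) set) \<Rightarrow> (nat \<Rightarrow> nat \<Rightarrow> nat) \<Rightarrow> (nat \<Rightarrow> nat) set" where
  "placement_aut k W a = (\<Inter>m\<in>{1..k}. (\<lambda>w. a m \<circ> w \<circ> Hilbert_Choice.inv (a m)) ` W m)"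

text \<open>
  The automorphism groups belonging to different representatives of a superposition are conjugate,
  so that their common order does not depend on the representative.
\<close>

definition odd_superpositions ::
  "nat \<Rightarrow> nat \<Rightarrow> (nat \<Rightarrow> (nat \<Rightarrow> nat) set) \<Rightarrow> (nat \<Rightarrow> nat \<Rightarrow> nat) set set" where
  "odd_superpositions d k W =
     {S \<in> superpositions d k W. \<exists>a\<in>S. odd (card (placement_aut k W a))}"


section \<open>Dihedral groups\<close>

text \<open>
  The dihedral group of order \<open>2 b\<close> for \<open>b \<ge> 1\<close>, as the semidirect product of \<open>\<int>/b\<close> with a group of
  order 2 acting by inversion: \<open>(i, e)\<close> stands for \<open>r\<^sup>i s\<^sup>e\<close>, and \<open>s r\<^sup>j = r\<^sup>-\<^sup>j s\<close>.
\<close>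

definition dihedral_group :: "nat \<Rightarrow> (int \<times> bool) monoid" where
  "dihedral_group b = \<lparr>carrier = {0..<int b} \<times> UNIV,
     monoid.mult = (\<lambda>(i, e) (j, f). ((if e then i - j else i + j) mod int b, e \<noteq> f)),
     one = (0, False)\<rparr>"

end

theory Submission
  imports Defs
    "HOL-Algebra.Multiplicative_Group"
    "HOL-Computational_Algebra.Polynomial_FPS"
begin

text \<open>
  Since \<open>ch\<close> is injective on class functions, the internal product of the cycle indices is \<open>ch\<close> of the
  pointwise product of the induced characters, and \<open>N (ch u)\<close> is the mean value of \<open>u\<close> on \<open>S\<^sub>d\<close>.
  Expanding the induced characters turns this mean into a sum over all placements \<open>a\<close> of the sum of
  \<open>\<sigma> \<mapsto> \<delta> (a\<^sub>1\<^sup>-\<^sup>1 \<sigma> a\<^sub>1)\<close> over the automorphism group of \<open>a\<close>. The inner sum is the order of the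
  automorphism group if this character is trivial and 0 otherwise, so by orbit counting the mean is the
  number of superpositions with trivial character. As \<open>b\<close> is odd, \<open>\<delta>\<close> is 1 exactly on the rotations,
  hence it is trivial on a subgroup of \<open>W\<^sub>1\<close> if and only if that subgroup has odd order.
\<close>

section \<open>Induced characters of finite groups\<close>

text \<open>Both \<open>internal_prod\<close> and \<open>N\<close> are defined by a choice, and this
  shapes the proof. \<open>ch_inv\<close> inverts \<open>ch\<close> on
  \<open>generalized_characters\<close> only, so each cycle index must come from a trace of actual
  matrices: induced characters are realised by matrices with one non-zero entry in each column, and
  Kronecker products keep every partial product among the characters, so that the next internal
  product can be formed. \<open>N\<close> selects some polynomial with the given series; its
  coefficient sum is independent of the selection, because x_i = 0 for i > 0 followed by x_0 = 1
  sends every p_s to 1. The counting argument is about an arbitrary finite group with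
  one-dimensional characters on several subgroups. Graphs and parity enter only at the end: since 2
  is invertible modulo an odd b, every rotation is the square of a rotation, and \<delta> takes the
  value 1 on such squares.\<close>

definition induced_character ::
    "('g, 'm) monoid_scheme \<Rightarrow> 'g set \<Rightarrow> ('g \<Rightarrow> 'k::field) \<Rightarrow> 'g \<Rightarrow> 'k" where
  "induced_character G H \<chi> g = inverse (of_nat (card H)) *
     (\<Sum>x\<in>carrier G. if inv\<^bsub>G\<^esub> x \<otimes>\<^bsub>G\<^esub> g \<otimes>\<^bsub>G\<^esub> x \<in> H then \<chi> (inv\<^bsub>G\<^esub> x \<otimes>\<^bsub>G\<^esub> g \<otimes>\<^bsub>G\<^esub> x) else 0)"

text \<open>Once \<open>m_assoc\<close> has nested a product to the right, these rules cancel an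
  element against its inverse at the head of the remaining word. Most word identities below are
  proved in this way.\<close>

lemma (in group) l_cancel_inv [simp]:
  "x \<in> carrier G \<Longrightarrow> y \<in> carrier G \<Longrightarrow> x \<otimes> (inv x \<otimes> y) = y"
  "x \<in> carrier G \<Longrightarrow> y \<in> carrier G \<Longrightarrow> inv x \<otimes> (x \<otimes> y) = y"
  by (simp_all add: m_assoc [symmetric])

locale finite_group_character = group G for G (structure) +
  fixes H :: "'a set" and \<chi> :: "'a \<Rightarrow> 'k::field_char_0"
  assumes fin: "finite (carrier G)"
    and sub: "subgroup H G"
    and hom: "\<chi> \<in> hom (G\<lparr>carrier := H\<rparr>) field_units"
begin

text \<open>With the value 0 off \<open>H\<close>, one function gives both the summands of the
  induced character and the entries of the inducing matrices.\<close>

definition ext :: "'a \<Rightarrow> 'k" where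
  "ext x = (if x \<in> H then \<chi> x else 0)"

lemma HG: "x \<in> H \<Longrightarrow> x \<in> carrier G"
  using sub by (rule subgroup.mem_carrier)

lemma fin_H [simp]: "finite H"
  by (rule finite_subset [OF _ fin]) (auto simp: HG)

lemma card_H_nonzero: "of_nat (card H) \<noteq> (0 :: 'k)"
  using subgroup.one_closed [OF sub] by auto

lemma H_closed [simp]: "x \<in> H \<Longrightarrow> y \<in> H \<Longrightarrow> x \<otimes> y \<in> H" "x \<in> H \<Longrightarrow> inv x \<in> H" "\<one> \<in> H"
  using sub by (simp_all add: subgroup.m_closed subgroup.m_inv_closed subgroup.one_closed)

lemma chi_mult: "x \<in> H \<Longrightarrow> y \<in> H \<Longrightarrow> \<chi> (x \<otimes> y) = \<chi> x * \<chi> y"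
  using hom by (auto simp: hom_def field_units_def)

lemma chi_nonzero: "x \<in> H \<Longrightarrow> \<chi> x \<noteq> 0"
  using hom by (auto simp: hom_def field_units_def)

lemma chi_one [simp]: "\<chi> \<one> = 1"
  using chi_mult [of \<one> \<one>] chi_nonzero [of \<one>] by simp

lemma mult_in_H_iff:
  assumes "x \<in> carrier G" "h \<in> H"
  shows "x \<otimes> h \<in> H \<longleftrightarrow> x \<in> H" "h \<otimes> x \<in> H \<longleftrightarrow> x \<in> H"
proof -
  have eq: "(x \<otimes> h) \<otimes> inv h = x" "inv h \<otimes> (h \<otimes> x) = x"
    using assms by (simp_all add: m_assoc HG)
  show "x \<otimes> h \<in> H \<longleftrightarrow> x \<in> H"
    using H_closed(1) [of "x \<otimes> h" "inv h", unfolded eq] H_closed(1,2) assms(2) by blast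
  show "h \<otimes> x \<in> H \<longleftrightarrow> x \<in> H"
    using H_closed(1) [of "inv h" "h \<otimes> x", unfolded eq] H_closed(1,2) assms(2) by blast
qed

lemma ext_mult: "x \<in> carrier G \<Longrightarrow> h \<in> H \<Longrightarrow> ext (x \<otimes> h) = ext x * \<chi> h"
  by (simp add: ext_def mult_in_H_iff chi_mult)

text \<open>On \<open>H\<close> the values commute, so the factors of \<open>h\<close> and its
  inverse cancel; off \<open>H\<close> both sides are 0, because multiplication by elements of
  \<open>H\<close> does not lead into \<open>H\<close>.\<close>

lemma ext_conj:
  assumes "x \<in> carrier G" "h \<in> H"
  shows "ext (inv h \<otimes> x \<otimes> h) = ext x"
proof (cases "x \<in> H")
  case True
  then have "\<chi> (inv h \<otimes> x \<otimes> h) = \<chi> x * (\<chi> (inv h) * \<chi> h)"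
    using assms by (simp add: chi_mult)
  also have "\<chi> (inv h) * \<chi> h = 1"
    using assms chi_mult [of "inv h" h] by (simp add: HG)
  finally have "\<chi> (inv h \<otimes> x \<otimes> h) = \<chi> x" by simp
  with True assms show ?thesis by (simp add: ext_def HG)
next
  case False
  with assms show ?thesis by (simp add: ext_def mult_in_H_iff HG)
qed

lemma chi_conj: "x \<in> H \<Longrightarrow> h \<in> H \<Longrightarrow> \<chi> (inv h \<otimes> x \<otimes> h) = \<chi> x"
  using ext_conj [of x h] by (simp add: ext_def HG)

lemma induced_eq_sum_ext:
  "induced_character G H \<chi> g = inverse (of_nat (card H)) * (\<Sum>x\<in>carrier G. ext (inv x \<otimes> g \<otimes> x))"
  by (simp add: induced_character_def ext_def)

lemma exists_transversal:
  obtains T where "T \<subseteq> carrier G" "\<And>g. g \<in> carrier G \<Longrightarrow> \<exists>!t. t \<in> T \<and> inv t \<otimes> g \<in> H"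
proof -
  \<comment> \<open>\<open>r g\<close> is chosen from the coset as a set and so depends on the coset
    alone; the uniqueness of the representative rests on this.\<close>
  define r where "r g = (SOME x. x \<in> g <# H)" for g
  have self: "g \<in> g <# H" if "g \<in> carrier G" for g
    using that by (auto simp: l_coset_def intro!: bexI [of _ \<one>])
  have r: "r g \<in> g <# H" if "g \<in> carrier G" for g
    unfolding r_def by (rule someI) (rule self [OF that])
  have coset: "x <# H = g <# H" if "g \<in> carrier G" "x \<in> g <# H" for g x
    using l_repr_independence [OF that(2,1) sub] by simp
  have coset_iff: "x \<in> g <# H \<longleftrightarrow> inv g \<otimes> x \<in> H" if "g \<in> carrier G" "x \<in> carrier G" for g x
  proof
    assume "inv g \<otimes> x \<in> H"
    then show "x \<in> g <# H"
      using that by (auto simp: l_coset_def intro!: bexI [of _ "inv g \<otimes> x"])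
  qed (use that HG in \<open>auto simp: l_coset_def\<close>)
  have rG: "r g \<in> carrier G" if "g \<in> carrier G" for g
    using r [OF that] that HG by (auto simp: l_coset_def)
  show ?thesis
  proof (rule that [of "r ` carrier G"])
    show "r ` carrier G \<subseteq> carrier G" using rG by auto
    fix g assume g: "g \<in> carrier G"
    show "\<exists>!t. t \<in> r ` carrier G \<and> inv t \<otimes> g \<in> H"
    proof (rule ex1I)
      have "r g <# H = g <# H" using coset g r by blast
      then have "g \<in> r g <# H" using self g by simp
      then show "r g \<in> r ` carrier G \<and> inv (r g) \<otimes> g \<in> H"
        using g rG coset_iff by auto
    next
      fix t assume t: "t \<in> r ` carrier G \<and> inv t \<otimes> g \<in> H"
      then obtain x where x: "x \<in> carrier G" "t = r x" by auto
      then have "g \<in> r x <# H" using t coset_iff g rG by auto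
      then have "g <# H = x <# H" using coset r rG x by metis
      then show "t = r g" using x by (simp add: r_def)
    qed
  qed
qed

text \<open>The matrix coefficients of the induced representation with respect to a left transversal.\<close>

lemma induced_kernel:
  obtains T where "finite T"
    "\<And>g h s t. g \<in> carrier G \<Longrightarrow> h \<in> carrier G \<Longrightarrow> s \<in> T \<Longrightarrow> t \<in> T \<Longrightarrow>
       ext (inv s \<otimes> (g \<otimes> h) \<otimes> t) = (\<Sum>r\<in>T. ext (inv s \<otimes> g \<otimes> r) * ext (inv r \<otimes> h \<otimes> t))"
    "\<And>s t. s \<in> T \<Longrightarrow> t \<in> T \<Longrightarrow> ext (inv s \<otimes> \<one> \<otimes> t) = (if s = t then 1 else 0)"
    "\<And>g. g \<in> carrier G \<Longrightarrow> induced_character G H \<chi> g = (\<Sum>t\<in>T. ext (inv t \<otimes> g \<otimes> t))"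
proof -
  obtain T where T: "T \<subseteq> carrier G"
    and rep: "\<And>g. g \<in> carrier G \<Longrightarrow> \<exists>!t. t \<in> T \<and> inv t \<otimes> g \<in> H"
    using exists_transversal by blast
  have TG: "t \<in> carrier G" if "t \<in> T" for t using that T by auto
  have finT: "finite T" using T fin by (rule finite_subset)
  show ?thesis
  proof (rule that [OF finT])
    fix g h s t assume gh: "g \<in> carrier G" "h \<in> carrier G" and st: "s \<in> T" "t \<in> T"
    obtain q where q: "q \<in> T" "inv q \<otimes> (h \<otimes> t) \<in> H"
      and uniq: "\<And>r. r \<in> T \<Longrightarrow> inv r \<otimes> (h \<otimes> t) \<in> H \<Longrightarrow> r = q"
      using rep [OF m_closed [OF gh(2) TG [OF st(2)]]] by blast
    \<comment> \<open>The element \<open>h \<otimes> t\<close> lies in the coset of exactly one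
      representative \<open>q\<close>, so column \<open>t\<close> of the matrix of \<open>h\<close>
      has a single non-zero entry.\<close>
    have "(\<Sum>r\<in>T. ext (inv s \<otimes> g \<otimes> r) * ext (inv r \<otimes> h \<otimes> t)) =
        (\<Sum>r\<in>{q}. ext (inv s \<otimes> g \<otimes> r) * ext (inv r \<otimes> h \<otimes> t))"
    proof (rule sum.mono_neutral_right [OF finT])
      show "\<forall>r\<in>T - {q}. ext (inv s \<otimes> g \<otimes> r) * ext (inv r \<otimes> h \<otimes> t) = 0"
      proof
        fix r assume r: "r \<in> T - {q}"
        then have "inv r \<otimes> (h \<otimes> t) \<notin> H" using uniq by blast
        then show "ext (inv s \<otimes> g \<otimes> r) * ext (inv r \<otimes> h \<otimes> t) = 0"
          using r gh st TG by (simp add: ext_def m_assoc)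
      qed
    qed (use q in simp)
    also have "\<dots> = ext (inv s \<otimes> g \<otimes> q) * \<chi> (inv q \<otimes> (h \<otimes> t))"
      using q gh st TG by (simp add: ext_def m_assoc)
    also have "\<dots> = ext (inv s \<otimes> g \<otimes> q \<otimes> (inv q \<otimes> (h \<otimes> t)))"
      using q gh st TG by (intro ext_mult [symmetric]) auto
    also have "inv s \<otimes> g \<otimes> q \<otimes> (inv q \<otimes> (h \<otimes> t)) = inv s \<otimes> (g \<otimes> h) \<otimes> t"
      using q gh st TG by (simp add: m_assoc)
    finally show "ext (inv s \<otimes> (g \<otimes> h) \<otimes> t) =
        (\<Sum>r\<in>T. ext (inv s \<otimes> g \<otimes> r) * ext (inv r \<otimes> h \<otimes> t))" ..
  next
    fix s t assume st: "s \<in> T" "t \<in> T"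
    have "inv t \<otimes> t \<in> H" using st TG by simp
    then have "inv s \<otimes> t \<in> H \<longleftrightarrow> s = t" using rep [of t] st TG by blast
    then show "ext (inv s \<otimes> \<one> \<otimes> t) = (if s = t then 1 else 0)"
      using st TG by (auto simp: ext_def)
  next
    fix g assume g: "g \<in> carrier G"
    \<comment> \<open>Every \<open>x\<close> is uniquely \<open>t \<otimes> h\<close> with
      \<open>t\<close> in \<open>T\<close> and \<open>h\<close> in \<open>H\<close>. By
      \<open>ext_conj\<close> the factor \<open>h\<close> has no effect, so each diagonal entry
      occurs \<open>card H\<close> times.\<close>
    have "(\<Sum>x\<in>carrier G. ext (inv x \<otimes> g \<otimes> x)) =
        (\<Sum>(t, h)\<in>T \<times> H. ext (inv (t \<otimes> h) \<otimes> g \<otimes> (t \<otimes> h)))"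
      unfolding case_prod_unfold
    proof (rule sum.reindex_bij_betw [symmetric])
      show "bij_betw (\<lambda>p. fst p \<otimes> snd p) (T \<times> H) (carrier G)"
        unfolding bij_betw_def
      proof (intro conjI inj_onI equalityI subsetI)
        fix p q assume pq: "p \<in> T \<times> H" "q \<in> T \<times> H"
          and eq: "fst p \<otimes> snd p = fst q \<otimes> snd q"
        have closed: "fst p \<in> carrier G" "snd p \<in> carrier G" "fst q \<in> carrier G" "snd q \<in> carrier G"
          using pq by (simp_all add: mem_Times_iff TG HG)
        then have cancel: "inv (fst p) \<otimes> (fst p \<otimes> snd p) = snd p"
          "inv (fst q) \<otimes> (fst p \<otimes> snd p) = snd q"
          by (simp, simp add: eq)
        have "fst p = fst q"
          using rep [of "fst p \<otimes> snd p"] pq cancel closed unfolding mem_Times_iff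
          by (metis m_closed)
        moreover from this have "snd p = snd q" using cancel by simp
        ultimately show "p = q" by (simp add: prod_eqI)
      next
        fix x assume x: "x \<in> carrier G"
        then obtain t where t: "t \<in> T" "inv t \<otimes> x \<in> H" using rep by blast
        then show "x \<in> (\<lambda>p. fst p \<otimes> snd p) ` (T \<times> H)"
          using x TG by (intro image_eqI [of _ _ "(t, inv t \<otimes> x)"]) simp_all
      next
        fix x assume "x \<in> (\<lambda>p. fst p \<otimes> snd p) ` (T \<times> H)"
        then obtain p where "p \<in> T \<times> H" "x = fst p \<otimes> snd p" by blast
        then show "x \<in> carrier G" by (simp add: mem_Times_iff TG HG)
      qed
    qed
    also have "\<dots> = (\<Sum>(t, h)\<in>T \<times> H. ext (inv t \<otimes> g \<otimes> t))"
    proof (rule sum.cong [OF refl], clarify)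
      fix t h assume th: "t \<in> T" "h \<in> H"
      have "inv (t \<otimes> h) \<otimes> g \<otimes> (t \<otimes> h) = inv h \<otimes> (inv t \<otimes> g \<otimes> t) \<otimes> h"
        using th TG HG g by (simp add: inv_mult_group m_assoc)
      then show "ext (inv (t \<otimes> h) \<otimes> g \<otimes> (t \<otimes> h)) = ext (inv t \<otimes> g \<otimes> t)"
        using th TG g by (simp add: ext_conj)
    qed
    also have "\<dots> = of_nat (card H) * (\<Sum>t\<in>T. ext (inv t \<otimes> g \<otimes> t))"
      by (simp add: sum.cartesian_product [symmetric] sum_distrib_left)
    finally show "induced_character G H \<chi> g = (\<Sum>t\<in>T. ext (inv t \<otimes> g \<otimes> t))"
      by (simp add: induced_eq_sum_ext mult.assoc [symmetric] left_inverse [OF card_H_nonzero])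
  qed
qed

text \<open>Translating the sum by an element \<open>y\<close> permutes its terms, but also
  multiplies it by \<chi> y; if \<chi> y is not 1, the sum must vanish.\<close>

lemma sum_character:
  "(\<Sum>x\<in>H. \<chi> x) = (if \<forall>x\<in>H. \<chi> x = 1 then of_nat (card H) else 0)"
proof (cases "\<forall>x\<in>H. \<chi> x = 1")
  case False
  then obtain y where y: "y \<in> H" "\<chi> y \<noteq> 1" by blast
  have "(\<Sum>x\<in>H. \<chi> x) = (\<Sum>x\<in>H. \<chi> (y \<otimes> x))"
    by (rule sum.reindex_bij_witness [where i = "\<lambda>x. y \<otimes> x" and j = "\<lambda>x. inv y \<otimes> x"])
      (use y HG in auto)
  also have "\<dots> = \<chi> y * (\<Sum>x\<in>H. \<chi> x)"
    using y by (simp add: chi_mult sum_distrib_left)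
  finally have "(\<chi> y - 1) * (\<Sum>x\<in>H. \<chi> x) = 0" by (simp add: algebra_simps)
  with y False show ?thesis by auto
qed simp

end

section \<open>Counting superpositions in a finite group\<close>

text \<open>All indices are treated alike, each subgroup having its own character. Taking the
  trivial character at all indices but one gives the situation of the theorem.\<close>

locale group_superposition = group G for G (structure) +
  fixes M :: "'i set" and W :: "'i \<Rightarrow> 'a set" and \<chi> :: "'i \<Rightarrow> 'a \<Rightarrow> 'k::field_char_0"
  assumes fin_M: "finite M"
    and fin: "finite (carrier G)"
    and character: "\<And>m. m \<in> M \<Longrightarrow> finite_group_character G (W m) (\<chi> m)"
begin

definition tuples :: "('i \<Rightarrow> 'a) set" where
  "tuples = (\<Pi>\<^sub>E m\<in>M. carrier G)"

definition rel :: "(('i \<Rightarrow> 'a) \<times> ('i \<Rightarrow> 'a)) set" where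
  "rel = {(a, b). a \<in> tuples \<and> b \<in> tuples \<and>
     (\<exists>\<zeta>\<in>carrier G. \<forall>m\<in>M. \<exists>w\<in>W m. b m = \<zeta> \<otimes> a m \<otimes> w)}"

text \<open>The intersection of the conjugates of the \<open>W m\<close> by the \<open>a m\<close>,
  written as a membership condition: these are the \<open>g\<close> for which no factor extended by
  zero vanishes in the expanded product of induced characters.\<close>

definition aut :: "('i \<Rightarrow> 'a) \<Rightarrow> 'a set" where
  "aut a = {g \<in> carrier G. \<forall>m\<in>M. inv (a m) \<otimes> g \<otimes> a m \<in> W m}"

definition aut_character :: "('i \<Rightarrow> 'a) \<Rightarrow> 'a \<Rightarrow> 'k" where
  "aut_character a g = (\<Prod>m\<in>M. \<chi> m (inv (a m) \<otimes> g \<otimes> a m))"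

lemma WG: "m \<in> M \<Longrightarrow> w \<in> W m \<Longrightarrow> w \<in> carrier G"
  using finite_group_character.HG [OF character] .

lemma tuples_closed: "a \<in> tuples \<Longrightarrow> m \<in> M \<Longrightarrow> a m \<in> carrier G"
  by (auto simp: tuples_def)

lemma finite_tuples [simp]: "finite tuples"
  unfolding tuples_def using fin_M fin by (intro finite_PiE) auto

text \<open>\<open>w\<close> is made extensional so that the pairs (\<zeta>, w) range over the
  finite product set that is counted in \<open>card_class\<close>.\<close>

lemma relE:
  assumes "(a, b) \<in> rel"
  obtains \<zeta> w where "\<zeta> \<in> carrier G" "w \<in> (\<Pi>\<^sub>E m\<in>M. W m)" "\<And>m. m \<in> M \<Longrightarrow> b m = \<zeta> \<otimes> a m \<otimes> w m"
    "a \<in> tuples" "b \<in> tuples"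
proof -
  obtain \<zeta> where \<zeta>: "\<zeta> \<in> carrier G" "\<forall>m\<in>M. \<exists>w\<in>W m. b m = \<zeta> \<otimes> a m \<otimes> w"
    and ab: "a \<in> tuples" "b \<in> tuples"
    using assms by (auto simp: rel_def)
  then obtain w where w: "\<forall>m\<in>M. w m \<in> W m \<and> b m = \<zeta> \<otimes> a m \<otimes> w m" by metis
  show ?thesis
    by (rule that [of \<zeta> "restrict w M"]) (use \<zeta> w ab in auto)
qed

lemma relI:
  assumes "\<zeta> \<in> carrier G" "\<And>m. m \<in> M \<Longrightarrow> w m \<in> W m" "\<And>m. m \<in> M \<Longrightarrow> b m = \<zeta> \<otimes> a m \<otimes> w m"
    "a \<in> tuples" "b \<in> tuples"
  shows "(a, b) \<in> rel"
  unfolding rel_def using assms by blast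

lemma equiv_rel: "equiv tuples rel"
proof (rule equivI)
  show "refl_on tuples rel"
  proof (rule refl_onI)
    fix a assume a: "a \<in> tuples"
    show "(a, a) \<in> rel"
      by (rule relI [of \<one> "\<lambda>_. \<one>"])
        (use a tuples_closed [OF a] finite_group_character.H_closed(3) [OF character] in auto)
  qed
  show "rel \<subseteq> tuples \<times> tuples" by (auto simp: rel_def)
  show "sym rel"
  proof (rule symI)
    fix a b assume "(a, b) \<in> rel"
    then obtain \<zeta> w where *: "\<zeta> \<in> carrier G" "w \<in> (\<Pi>\<^sub>E m\<in>M. W m)"
      "\<And>m. m \<in> M \<Longrightarrow> b m = \<zeta> \<otimes> a m \<otimes> w m" "a \<in> tuples" "b \<in> tuples"
      by (rule relE) blast
    have wW: "w m \<in> W m" if "m \<in> M" for m using *(2) that by auto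
    show "(b, a) \<in> rel"
    proof (rule relI [of "inv \<zeta>" "\<lambda>m. inv (w m)"])
      fix m assume m: "m \<in> M"
      show "inv (w m) \<in> W m" using finite_group_character.H_closed(2) [OF character] wW m by blast
      show "a m = inv \<zeta> \<otimes> b m \<otimes> inv (w m)"
        using * m wW [OF m] by (simp add: m_assoc WG tuples_closed)
    qed (use * in auto)
  qed
  show "trans rel"
  proof (rule transI)
    fix a b c assume "(a, b) \<in> rel" "(b, c) \<in> rel"
    obtain \<zeta> w where *: "\<zeta> \<in> carrier G" "w \<in> (\<Pi>\<^sub>E m\<in>M. W m)"
      "\<And>m. m \<in> M \<Longrightarrow> b m = \<zeta> \<otimes> a m \<otimes> w m" "a \<in> tuples" "b \<in> tuples"
      using \<open>(a, b) \<in> rel\<close> by (rule relE) blast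
    obtain \<xi> v where **: "\<xi> \<in> carrier G" "v \<in> (\<Pi>\<^sub>E m\<in>M. W m)"
      "\<And>m. m \<in> M \<Longrightarrow> c m = \<xi> \<otimes> b m \<otimes> v m" "b \<in> tuples" "c \<in> tuples"
      using \<open>(b, c) \<in> rel\<close> by (rule relE) blast
    have wv: "w m \<in> W m" "v m \<in> W m" if "m \<in> M" for m using *(2) **(2) that by auto
    show "(a, c) \<in> rel"
    proof (rule relI [of "\<xi> \<otimes> \<zeta>" "\<lambda>m. w m \<otimes> v m"])
      fix m assume m: "m \<in> M"
      show "w m \<otimes> v m \<in> W m" using finite_group_character.H_closed(1) [OF character] wv m by blast
      show "c m = \<xi> \<otimes> \<zeta> \<otimes> a m \<otimes> (w m \<otimes> v m)"
        using * ** m wv [OF m] by (simp add: m_assoc WG tuples_closed)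
    qed (use * ** in auto)
  qed
qed

text \<open>If b m = \<zeta> a m w m, conjugation by \<zeta> takes \<open>aut a\<close> to
  \<open>aut b\<close>. The arguments of the characters then change only by conjugation with w m
  inside \<open>W m\<close>, which leaves a one-dimensional character unchanged.\<close>

lemma aut_character_trivial_cong:
  assumes rel: "(a, b) \<in> rel" and triv: "\<forall>g\<in>aut a. aut_character a g = 1"
  shows "\<forall>g\<in>aut b. aut_character b g = 1"
proof
  fix h assume h: "h \<in> aut b"
  then have hG: "h \<in> carrier G" by (simp add: aut_def)
  obtain \<zeta> w where *: "\<zeta> \<in> carrier G" "w \<in> (\<Pi>\<^sub>E m\<in>M. W m)"
    "\<And>m. m \<in> M \<Longrightarrow> b m = \<zeta> \<otimes> a m \<otimes> w m" "a \<in> tuples" "b \<in> tuples"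
    using rel by (rule relE) blast
  have wW: "w m \<in> W m" if "m \<in> M" for m using *(2) that by auto
  define g where "g = inv \<zeta> \<otimes> h \<otimes> \<zeta>"
  have gG: "g \<in> carrier G" using * hG by (simp add: g_def)
  have conj: "inv (a m) \<otimes> g \<otimes> a m = inv (inv (w m)) \<otimes> (inv (b m) \<otimes> h \<otimes> b m) \<otimes> inv (w m)"
    if "m \<in> M" for m
    using * that wW [OF that] hG by (simp add: g_def m_assoc inv_mult_group WG tuples_closed)
  have inW: "inv (b m) \<otimes> h \<otimes> b m \<in> W m" "inv (w m) \<in> W m" if "m \<in> M" for m
    using h that finite_group_character.H_closed(2) [OF character] wW by (auto simp: aut_def)
  have "inv (a m) \<otimes> g \<otimes> a m \<in> W m" if "m \<in> M" for m
    unfolding conj [OF that] using inW [OF that] finite_group_character.H_closed [OF character [OF that]]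
    by metis
  then have "g \<in> aut a" using gG by (simp add: aut_def)
  moreover have "aut_character b h = aut_character a g"
    unfolding aut_character_def
  proof (rule prod.cong [OF refl])
    fix m assume m: "m \<in> M"
    show "\<chi> m (inv (b m) \<otimes> h \<otimes> b m) = \<chi> m (inv (a m) \<otimes> g \<otimes> a m)"
      unfolding conj [OF m] using finite_group_character.chi_conj [OF character [OF m]] inW [OF m] by metis
  qed
  ultimately show "aut_character b h = 1" using triv by simp
qed

lemma character_aut:
  assumes a: "a \<in> tuples"
  shows "finite_group_character G (aut a) (aut_character a)"
proof -
  have mult: "inv (a m) \<otimes> (g \<otimes> h) \<otimes> a m = (inv (a m) \<otimes> g \<otimes> a m) \<otimes> (inv (a m) \<otimes> h \<otimes> a m)"
    if "g \<in> carrier G" "h \<in> carrier G" "m \<in> M" for g h m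
    using that tuples_closed [OF a] by (simp add: m_assoc)
  have inv: "inv (a m) \<otimes> inv g \<otimes> a m = inv (inv (a m) \<otimes> g \<otimes> a m)"
    if "g \<in> carrier G" "m \<in> M" for g m
    using that tuples_closed [OF a] by (simp add: m_assoc inv_mult_group)
  note W = finite_group_character.H_closed [OF character]
  have sub: "subgroup (aut a) G"
  proof (rule subgroupI)
    have "inv (a m) \<otimes> \<one> \<otimes> a m \<in> W m" if "m \<in> M" for m
      using that tuples_closed [OF a that] W(3) by simp
    then have "\<one> \<in> aut a" by (simp add: aut_def)
    then show "aut a \<noteq> {}" by blast
  next
    fix g assume g: "g \<in> aut a"
    then have "inv (a m) \<otimes> inv g \<otimes> a m \<in> W m" if "m \<in> M" for m
      using that W(2) inv by (simp add: aut_def)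
    then show "inv g \<in> aut a" using g by (simp add: aut_def)
  next
    fix g h assume gh: "g \<in> aut a" "h \<in> aut a"
    then have "inv (a m) \<otimes> (g \<otimes> h) \<otimes> a m \<in> W m" if "m \<in> M" for m
      using that W(1) mult by (simp add: aut_def)
    then show "g \<otimes> h \<in> aut a" using gh by (simp add: aut_def)
  qed (auto simp: aut_def)
  have "aut_character a (g \<otimes> h) = aut_character a g * aut_character a h"
    if "g \<in> aut a" "h \<in> aut a" for g h
    unfolding aut_character_def prod.distrib [symmetric]
  proof (rule prod.cong [OF refl])
    fix m assume m: "m \<in> M"
    show "\<chi> m (inv (a m) \<otimes> (g \<otimes> h) \<otimes> a m) =
        \<chi> m (inv (a m) \<otimes> g \<otimes> a m) * \<chi> m (inv (a m) \<otimes> h \<otimes> a m)"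
      using that m mult finite_group_character.chi_mult [OF character [OF m]] by (simp add: aut_def)
  qed
  moreover have "aut_character a g \<noteq> 0" if "g \<in> aut a" for g
    using that fin_M finite_group_character.chi_nonzero [OF character]
    by (auto simp: aut_character_def aut_def)
  ultimately have "aut_character a \<in> hom (G\<lparr>carrier := aut a\<rparr>) field_units"
    by (auto simp: hom_def field_units_def)
  with sub fin show ?thesis
    by (intro finite_group_character.intro finite_group_character_axioms.intro group_axioms)
qed

text \<open>An orbit-stabiliser count done by fibres: (\<zeta>, w) is sent to the placement \<zeta>
  a w, the image is the class of \<open>a\<close>, and every fibre is in bijection with
  \<open>aut a\<close>.\<close>

lemma card_class:
  assumes a: "a \<in> tuples"
  shows "card (rel `` {a}) * card (aut a) = card (carrier G) * (\<Prod>m\<in>M. card (W m))"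
proof -
  define Q where "Q = carrier G \<times> (\<Pi>\<^sub>E m\<in>M. W m)"
  define f where "f = (\<lambda>(\<zeta>, w). \<lambda>m\<in>M. \<zeta> \<otimes> a m \<otimes> w m)"
  have finW: "finite (W m)" if "m \<in> M" for m
    using finite_group_character.fin_H [OF character [OF that]] .
  have finQ: "finite Q"
    unfolding Q_def using fin fin_M finW by (intro finite_cartesian_product finite_PiE) auto
  note aG = tuples_closed [OF a]
  have fQ: "f ` Q = rel `` {a}"
  proof (intro equalityI subsetI)
    fix b assume "b \<in> f ` Q"
    then obtain \<zeta> w where *: "\<zeta> \<in> carrier G" "w \<in> (\<Pi>\<^sub>E m\<in>M. W m)" "b = (\<lambda>m\<in>M. \<zeta> \<otimes> a m \<otimes> w m)"
      by (auto simp: Q_def f_def)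
    have wW: "w m \<in> W m" if "m \<in> M" for m using *(2) that by auto
    have "(a, b) \<in> rel"
      by (rule relI [of \<zeta> w]) (use * a wW aG WG in \<open>simp_all add: tuples_def\<close>)
    then show "b \<in> rel `` {a}" by simp
  next
    fix b assume "b \<in> rel `` {a}"
    then have "(a, b) \<in> rel" by simp
    then obtain \<zeta> w where *: "\<zeta> \<in> carrier G" "w \<in> (\<Pi>\<^sub>E m\<in>M. W m)"
      "\<And>m. m \<in> M \<Longrightarrow> b m = \<zeta> \<otimes> a m \<otimes> w m" "a \<in> tuples" "b \<in> tuples"
      by (rule relE) blast
    have "b = f (\<zeta>, w)"
    proof
      fix m show "b m = f (\<zeta>, w) m"
        using * by (cases "m \<in> M") (auto simp: f_def tuples_def)
    qed
    then show "b \<in> f ` Q" using * by (simp add: Q_def)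
  qed
  have fiber: "card {q \<in> Q. f q = b} = card (aut a)" if b: "b \<in> rel `` {a}" for b
  proof -
    have "(a, b) \<in> rel" using b by simp
    then obtain \<zeta> w where *: "\<zeta> \<in> carrier G" "w \<in> (\<Pi>\<^sub>E m\<in>M. W m)"
      "\<And>m. m \<in> M \<Longrightarrow> b m = \<zeta> \<otimes> a m \<otimes> w m" "a \<in> tuples" "b \<in> tuples"
      by (rule relE) blast
    have wW: "w m \<in> W m" if "m \<in> M" for m using *(2) that by auto
    \<comment> \<open>Any preimage of \<open>b\<close> can be written (\<zeta> g, v). Solving
      \<zeta> g (a m) (v m) = \<zeta> (a m) (w m) for v m gives the second component, and v m lies
      in \<open>W m\<close> exactly when g satisfies the condition of \<open>aut a\<close> at
      m.\<close>
    have "bij_betw (\<lambda>g. (\<zeta> \<otimes> g, \<lambda>m\<in>M. inv (inv (a m) \<otimes> g \<otimes> a m) \<otimes> w m)) (aut a) {q \<in> Q. f q = b}"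
    proof (rule bij_betwI')
      fix g h assume "g \<in> aut a" "h \<in> aut a"
      then show "((\<zeta> \<otimes> g, \<lambda>m\<in>M. inv (inv (a m) \<otimes> g \<otimes> a m) \<otimes> w m) =
          (\<zeta> \<otimes> h, \<lambda>m\<in>M. inv (inv (a m) \<otimes> h \<otimes> a m) \<otimes> w m)) = (g = h)"
        using *(1) by (auto simp: aut_def)
    next
      fix g assume g: "g \<in> aut a"
      define v where "v = (\<lambda>m\<in>M. inv (inv (a m) \<otimes> g \<otimes> a m) \<otimes> w m)"
      have gG: "g \<in> carrier G" using g by (simp add: aut_def)
      have "v m \<in> W m" if "m \<in> M" for m
        using g that wW finite_group_character.H_closed(1,2) [OF character [OF that]]
        by (simp add: aut_def v_def)
      then have "(\<zeta> \<otimes> g, v) \<in> Q" using * gG by (auto simp: Q_def v_def)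
      moreover have "f (\<zeta> \<otimes> g, v) = b"
      proof
        fix m
        show "f (\<zeta> \<otimes> g, v) m = b m"
        proof (cases "m \<in> M")
          case True
          then show ?thesis
            using * gG wW [OF True] aG [OF True] WG [OF True wW [OF True]]
            by (simp add: f_def v_def inv_mult_group m_assoc)
        qed (use * in \<open>auto simp: f_def tuples_def\<close>)
      qed
      ultimately show "(\<zeta> \<otimes> g, \<lambda>m\<in>M. inv (inv (a m) \<otimes> g \<otimes> a m) \<otimes> w m) \<in> {q \<in> Q. f q = b}"
        by (simp add: v_def)
    next
      fix q assume q: "q \<in> {q \<in> Q. f q = b}"
      then obtain \<xi> v where qv: "q = (\<xi>, v)" "\<xi> \<in> carrier G" "v \<in> (\<Pi>\<^sub>E m\<in>M. W m)"
        and eq: "f (\<xi>, v) = b"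
        by (auto simp: Q_def)
      have vW: "v m \<in> W m" if "m \<in> M" for m using qv that by auto
      define g where "g = inv \<zeta> \<otimes> \<xi>"
      have gG: "g \<in> carrier G" using * qv by (simp add: g_def)
      have \<xi>: "\<xi> = \<zeta> \<otimes> g" using * qv by (simp add: g_def)
      have ga: "g \<otimes> a m = a m \<otimes> (w m \<otimes> inv (v m))" if m: "m \<in> M" for m
      proof -
        have "\<zeta> \<otimes> g \<otimes> a m \<otimes> v m = \<zeta> \<otimes> a m \<otimes> w m"
          using fun_cong [OF eq, of m] m * by (simp add: f_def \<xi>)
        then have "inv \<zeta> \<otimes> (\<zeta> \<otimes> g \<otimes> a m \<otimes> v m) \<otimes> inv (v m) = inv \<zeta> \<otimes> (\<zeta> \<otimes> a m \<otimes> w m) \<otimes> inv (v m)"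
          by simp
        then show ?thesis
          using * gG m WG [OF m wW [OF m]] WG [OF m vW [OF m]] aG [OF m]
          by (simp add: m_assoc)
      qed
      have quot: "inv (a m) \<otimes> g \<otimes> a m = w m \<otimes> inv (v m)" if m: "m \<in> M" for m
        using ga [OF m] gG m WG [OF m wW [OF m]] WG [OF m vW [OF m]] aG [OF m]
        by (simp add: m_assoc)
      have "g \<in> aut a"
        using gG quot wW vW finite_group_character.H_closed(1,2) [OF character]
        by (simp add: aut_def)
      moreover have "(\<lambda>m\<in>M. inv (inv (a m) \<otimes> g \<otimes> a m) \<otimes> w m) = v"
      proof
        fix m
        show "(\<lambda>m\<in>M. inv (inv (a m) \<otimes> g \<otimes> a m) \<otimes> w m) m = v m"
        proof (cases "m \<in> M")
          case True
          then show ?thesis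
            using WG [OF True wW [OF True]] WG [OF True vW [OF True]]
            by (simp add: quot inv_mult_group m_assoc)
        qed (use qv in auto)
      qed
      ultimately show "\<exists>g\<in>aut a. q = (\<zeta> \<otimes> g, \<lambda>m\<in>M. inv (inv (a m) \<otimes> g \<otimes> a m) \<otimes> w m)"
        using qv \<xi> by blast
    qed
    then show ?thesis by (simp add: bij_betw_same_card)
  qed
  have "card Q = (\<Sum>b\<in>f ` Q. card {q \<in> Q. f q = b})"
    using sum.image_gen [OF finQ, of "\<lambda>_. 1 :: nat" f] by simp
  also have "\<dots> = card (rel `` {a}) * card (aut a)"
    using fiber by (simp add: fQ)
  finally show ?thesis
    by (simp add: Q_def card_cartesian_product card_PiE [OF fin_M])
qed

text \<open>This moves the automorphism group of a placement into \<open>W m\<close>, where the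
  character is defined, without changing its order.\<close>

lemma conj_aut_subgroup:
  assumes a: "a \<in> tuples" and m: "m \<in> M"
  shows "subgroup ((\<lambda>g. inv (a m) \<otimes> g \<otimes> a m) ` aut a) (G\<lparr>carrier := W m\<rparr>)"
    and "card ((\<lambda>g. inv (a m) \<otimes> g \<otimes> a m) ` aut a) = card (aut a)"
proof -
  let ?f = "\<lambda>g. inv (a m) \<otimes> g \<otimes> a m"
  have am: "a m \<in> carrier G" by (rule tuples_closed [OF a m])
  have sub: "subgroup (aut a) G" by (rule finite_group_character.sub [OF character_aut [OF a]])
  interpret conj: group_hom G G ?f
    by unfold_locales (use am in \<open>auto simp: hom_def m_assoc\<close>)
  have "subgroup (?f ` aut a) G" by (rule conj.subgroup_img_is_subgroup [OF sub])
  then show "subgroup (?f ` aut a) (G\<lparr>carrier := W m\<rparr>)"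
    by (rule subgroup_incl [OF _ finite_group_character.sub [OF character [OF m]]])
      (use m in \<open>auto simp: aut_def\<close>)
  have "inj_on ?f (aut a)"
    by (rule inj_onI) (use am in \<open>simp add: aut_def\<close>)
  then show "card (?f ` aut a) = card (aut a)" by (rule card_image)
qed

theorem sum_induced_characters:
  "inverse (of_nat (card (carrier G))) *
     (\<Sum>g\<in>carrier G. \<Prod>m\<in>M. induced_character G (W m) (\<chi> m) g) =
   of_nat (card {S \<in> tuples // rel. \<exists>a\<in>S. \<forall>g\<in>aut a. aut_character a g = 1})"
proof -
  define triv where "triv a \<longleftrightarrow> (\<forall>g\<in>aut a. aut_character a g = 1)" for a
  define e where "e m = finite_group_character.ext (W m) (\<chi> m)" for m
  \<comment> \<open>By \<open>card_class\<close>, size of a class times order of an automorphism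
    group is always n. So each class with trivial character contributes exactly n, which the
    normalising factors cancel.\<close>
  define n where "n = card (carrier G) * (\<Prod>m\<in>M. card (W m))"
  have e: "e m x = (if x \<in> W m then \<chi> m x else 0)" if "m \<in> M" for m x
    unfolding e_def by (rule finite_group_character.ext_def [OF character [OF that]])
  have n0: "(of_nat n :: 'k) \<noteq> 0"
    using finite_group_character.card_H_nonzero [OF character] fin_M fin one_closed
    by (auto simp: n_def)
  have prod_e: "(\<Prod>m\<in>M. e m (inv (a m) \<otimes> g \<otimes> a m)) = (if g \<in> aut a then aut_character a g else 0)"
    if "g \<in> carrier G" for a g
    using that e fin_M by (auto simp: aut_def aut_character_def intro!: prod_zero)
  have inner: "(\<Sum>g\<in>carrier G. \<Prod>m\<in>M. e m (inv (a m) \<otimes> g \<otimes> a m)) =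
      (if triv a then of_nat (card (aut a)) else 0)" if "a \<in> tuples" for a
  proof -
    have "(\<Sum>g\<in>carrier G. \<Prod>m\<in>M. e m (inv (a m) \<otimes> g \<otimes> a m)) =
        (\<Sum>g\<in>carrier G. if g \<in> aut a then aut_character a g else 0)"
      using prod_e by (intro sum.cong) auto
    also have "\<dots> = (\<Sum>g\<in>carrier G \<inter> aut a. aut_character a g)"
      using fin by (simp add: sum.inter_restrict)
    also have "carrier G \<inter> aut a = aut a" by (auto simp: aut_def)
    also have "sum (aut_character a) (aut a) = (if triv a then of_nat (card (aut a)) else 0)"
      using finite_group_character.sum_character [OF character_aut [OF that]] by (simp add: triv_def)
    finally show ?thesis .
  qed
  have "(\<Sum>g\<in>carrier G. \<Prod>m\<in>M. induced_character G (W m) (\<chi> m) g) =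
      (\<Sum>g\<in>carrier G. \<Prod>m\<in>M. inverse (of_nat (card (W m))) * (\<Sum>x\<in>carrier G. e m (inv x \<otimes> g \<otimes> x)))"
    by (intro sum.cong prod.cong)
      (simp_all add: e_def finite_group_character.induced_eq_sum_ext [OF character])
  \<comment> \<open>The product is distributed over the inner sums: choosing a conjugating element
    for each index is choosing a placement.\<close>
  also have "\<dots> = (\<Prod>m\<in>M. inverse (of_nat (card (W m)))) *
      (\<Sum>g\<in>carrier G. \<Sum>a\<in>tuples. \<Prod>m\<in>M. e m (inv (a m) \<otimes> g \<otimes> a m))"
    using fin fin_M by (simp add: prod.distrib prod_sum_PiE tuples_def sum_distrib_left)
  also have "(\<Sum>g\<in>carrier G. \<Sum>a\<in>tuples. \<Prod>m\<in>M. e m (inv (a m) \<otimes> g \<otimes> a m)) =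
      (\<Sum>a\<in>tuples. if triv a then of_nat (card (aut a)) else 0)"
    by (subst sum.swap) (simp add: inner)
  also have "\<dots> = (\<Sum>S\<in>tuples // rel. \<Sum>a\<in>S. if triv a then of_nat (card (aut a)) else 0)"
  proof -
    have "\<Union> (tuples // rel) = tuples" by (rule Union_quotient [OF equiv_rel])
    moreover have "\<forall>A\<in>tuples // rel. finite A"
      using finite_equiv_class [OF finite_tuples] equiv_rel by (auto simp: equiv_def)
    moreover have "\<forall>A\<in>tuples // rel. \<forall>B\<in>tuples // rel. A \<noteq> B \<longrightarrow> A \<inter> B = {}"
      using quotient_disj [OF equiv_rel] by blast
    ultimately show ?thesis using sum.Union_disjoint [of "tuples // rel"] by (simp add: comp_def)
  qed
  also have "\<dots> = (\<Sum>S\<in>tuples // rel. if \<exists>a\<in>S. triv a then of_nat n else 0)"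
  proof (rule sum.cong [OF refl])
    fix S assume S: "S \<in> tuples // rel"
    have cls: "S = rel `` {a}" "a \<in> tuples" if "a \<in> S" for a
      using S that equiv_rel by (auto simp: quotient_def equiv_class_eq_iff dest: equiv_class_eq)
    have triv_iff: "triv a \<longleftrightarrow> (\<exists>a\<in>S. triv a)" if "a \<in> S" for a
      using that cls aut_character_trivial_cong unfolding triv_def by blast
    have "S \<noteq> {}" using S equiv_rel by (metis in_quotient_imp_non_empty)
    then obtain a where a: "a \<in> S" by blast
    have finS: "finite S" using cls [OF a] finite_equiv_class [OF finite_tuples] equiv_rel S
      by (auto simp: equiv_def)
    have card: "card S * card (aut b) = n" if "b \<in> S" for b
      using card_class [of b] cls [OF that] by (simp add: n_def)
    have aut_eq: "card (aut b) = card (aut a)" if "b \<in> S" for b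
      using card [OF that] card [OF a] a finS by (metis card_0_eq empty_iff mult_left_cancel)
    have "(\<Sum>b\<in>S. if triv b then of_nat (card (aut b)) else 0 :: 'k) =
        (\<Sum>b\<in>S. if \<exists>a\<in>S. triv a then of_nat (card (aut a)) else 0)"
      by (intro sum.cong refl if_cong triv_iff) (simp_all add: aut_eq)
    also have "\<dots> = (if \<exists>a\<in>S. triv a then of_nat n else 0)"
      by (simp add: card [OF a, symmetric])
    finally show "(\<Sum>b\<in>S. if triv b then of_nat (card (aut b)) else 0 :: 'k) =
        (if \<exists>a\<in>S. triv a then of_nat n else 0)" .
  qed
  also have "\<dots> = of_nat n * of_nat (card {S \<in> tuples // rel. \<exists>a\<in>S. triv a})"
  proof -
    have "finite (tuples // rel)"
      using finite_quotient [OF finite_tuples] equiv_rel by (auto simp: equiv_def)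
    then show ?thesis by (simp add: sum.If_cases Int_def)
  qed
  finally have "(\<Sum>g\<in>carrier G. \<Prod>m\<in>M. induced_character G (W m) (\<chi> m) g) =
    (\<Prod>m\<in>M. inverse (of_nat (card (W m)))) * (of_nat n * of_nat (card {S \<in> tuples // rel. \<exists>a\<in>S. triv a}))" .
  moreover have "inverse (of_nat (card (carrier G))) * (\<Prod>m\<in>M. inverse (of_nat (card (W m)))) =
      (inverse (of_nat n) :: 'k)"
    by (simp add: n_def prod_inversef [symmetric] comp_def)
  ultimately show ?thesis
    using n0 by (simp add: mult.assoc [symmetric] triv_def)
qed

end

section \<open>Power sums and the sum of coefficients\<close>

lemma mcoeff_mscale [simp]: "mcoeff (mscale c f) m = c * mcoeff f m"
  by (simp add: mscale.rep_eq)

lemma mcoeff_add [simp]: "mcoeff (f + g) m = mcoeff f m + mcoeff g m"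
  by (simp add: plus_mseries.rep_eq)

lemma mcoeff_zero [simp]: "mcoeff 0 m = 0"
  by (simp add: zero_mseries.rep_eq)

lemma mcoeff_sum: "mcoeff (\<Sum>x\<in>A. f x) m = (\<Sum>x\<in>A. mcoeff (f x) m)"
  by (induction A rule: infinite_finite_induct) simp_all

lemma mscale_mscale: "mscale c (mscale e f) = mscale (c * e) f"
  by (rule mseries_eqI) (simp add: mult.assoc)

lemma mscale_sum_right: "mscale c (\<Sum>x\<in>A. f x) = (\<Sum>x\<in>A. mscale c (f x))"
  by (rule mseries_eqI) (simp add: mcoeff_sum sum_distrib_left)

lemma mscale_sum_left: "mscale (\<Sum>x\<in>A. c x) f = (\<Sum>x\<in>A. mscale (c x) f)"
  by (rule mseries_eqI) (simp add: mcoeff_sum sum_distrib_right)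

text \<open>Setting \<open>x\<^sub>i = 0\<close> for \<open>i > 0\<close> turns \<open>p\<^sub>s\<close> into \<open>x\<^sub>0\<^sup>s\<close>, whose value at 1 is 1.\<close>

definition first_variable :: "'a::comm_ring_1 mseries \<Rightarrow> 'a fps" where
  "first_variable f = Abs_fps (\<lambda>n. mcoeff f (Poly_Mapping.single 0 n))"

text \<open>A power of one variable is divisible only by powers of that variable, so on such
  monomials the convolution of series becomes the Cauchy product of power series in one
  variable.\<close>

lemma msplit_single:
  "msplit (Poly_Mapping.single k n) =
     (\<lambda>i. (Poly_Mapping.single k i, Poly_Mapping.single k (n - i))) ` {0..n}" (is "?L = ?R")
proof (intro equalityI subsetI)
  fix p assume "p \<in> ?L"
  then obtain a b where p: "p = (a, b)" and ab: "a + b = Poly_Mapping.single k n"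
    by (auto simp: msplit_def)
  have sum: "Poly_Mapping.lookup a j + Poly_Mapping.lookup b j = (if j = k then n else 0)" for j
    using arg_cong [OF ab, of "\<lambda>m. Poly_Mapping.lookup m j"] by (simp add: lookup_add lookup_single when_def)
  have "a = Poly_Mapping.single k (Poly_Mapping.lookup a k)"
  proof (rule poly_mapping_eqI)
    fix j show "Poly_Mapping.lookup a j = Poly_Mapping.lookup (Poly_Mapping.single k (Poly_Mapping.lookup a k)) j"
      using sum [of j] by (auto simp: lookup_single when_def split: if_splits)
  qed
  moreover have "b = Poly_Mapping.single k (n - Poly_Mapping.lookup a k)"
  proof (rule poly_mapping_eqI)
    fix j show "Poly_Mapping.lookup b j = Poly_Mapping.lookup (Poly_Mapping.single k (n - Poly_Mapping.lookup a k)) j"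
      using sum [of j] by (auto simp: lookup_single when_def split: if_splits)
  qed
  moreover have "Poly_Mapping.lookup a k \<in> {0..n}" using sum [of k] by simp
  ultimately show "p \<in> ?R" unfolding p by blast
qed (auto simp: msplit_def single_add [symmetric])

lemma first_variable_mult: "first_variable (f * g) = first_variable f * first_variable g"
proof (rule fps_ext)
  fix n :: nat
  have "inj_on (\<lambda>i. (Poly_Mapping.single (0::nat) i, Poly_Mapping.single (0::nat) (n - i))) {0..n}"
    by (rule inj_onI) (metis fst_conv lookup_single_eq)
  then show "fps_nth (first_variable (f * g)) n = fps_nth (first_variable f * first_variable g) n"
    by (simp add: first_variable_def times_mseries.rep_eq msplit_single sum.reindex fps_mult_nth)
qed

lemma first_variable_one: "first_variable 1 = 1"
  by (rule fps_ext) (auto simp: first_variable_def one_mseries.rep_eq single_zero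
      dest: arg_cong [of _ _ "\<lambda>m. Poly_Mapping.lookup m 0"])

lemma first_variable_power: "first_variable (f ^ n) = first_variable f ^ n"
  by (induction n) (simp_all add: first_variable_one first_variable_mult)

lemma first_variable_prod: "first_variable (\<Prod>x\<in>A. f x) = (\<Prod>x\<in>A. first_variable (f x))"
  by (induction A rule: infinite_finite_induct) (simp_all add: first_variable_one first_variable_mult)

lemma first_variable_sum: "first_variable (\<Sum>x\<in>A. f x) = (\<Sum>x\<in>A. first_variable (f x))"
  by (rule fps_ext) (simp add: first_variable_def mcoeff_sum fps_sum_nth)

lemma first_variable_mscale: "first_variable (mscale c f) = fps_const c * first_variable f"
  by (rule fps_ext) (simp add: first_variable_def)

lemma first_variable_power_sum:
  assumes "s > 0"
  shows "first_variable (power_sum s) = fps_X ^ s"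
proof (rule fps_ext)
  fix n
  have "(\<exists>i. Poly_Mapping.single (0::nat) n = Poly_Mapping.single i s) \<longleftrightarrow> n = s"
  proof
    assume "\<exists>i. Poly_Mapping.single (0::nat) n = Poly_Mapping.single i s"
    then obtain i where i: "Poly_Mapping.single (0::nat) n = Poly_Mapping.single i s" ..
    have "Poly_Mapping.lookup (Poly_Mapping.single (0::nat) n) i = s"
      unfolding i by simp
    then show "n = s" using assms by (simp add: lookup_single when_def split: if_splits)
  qed auto
  then show "fps_nth (first_variable (power_sum s)) n = fps_nth (fps_X ^ s) n"
    by (simp add: first_variable_def power_sum.rep_eq fps_X_power_nth)
qed

text \<open>The image is a polynomial, in which the s-th indeterminate has weight s; unlike a power
  series it can be evaluated at 1.\<close>

lemma first_variable_eval_power_sums: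
  fixes P :: "(nat \<Rightarrow>\<^sub>0 nat) \<Rightarrow>\<^sub>0 'a::comm_ring_1"
  shows "first_variable (eval_power_sums d P) = fps_of_poly (\<Sum>m\<in>Poly_Mapping.keys P.
     Polynomial.monom (Poly_Mapping.lookup P m) (\<Sum>s=1..d. s * Poly_Mapping.lookup m s))"
proof -
  have "first_variable (\<Prod>s=1..d. power_sum s ^ Poly_Mapping.lookup m s :: 'a mseries) =
      fps_X ^ (\<Sum>s=1..d. s * Poly_Mapping.lookup m s)" for m
    by (simp add: first_variable_prod first_variable_power first_variable_power_sum
        power_mult [symmetric] power_sum)
  then show ?thesis
    by (simp add: eval_power_sums_def first_variable_sum first_variable_mscale fps_of_poly_sum
        fps_of_poly_monom)
qed

text \<open>The polynomial \<open>Q\<close> selected by \<open>N\<close> has the same series as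
  \<open>P\<close>, hence the same specialisation to one variable, and the value of that at 1 is the
  coefficient sum of either.\<close>

lemma N_eval_power_sums:
  fixes P :: "(nat \<Rightarrow>\<^sub>0 nat) \<Rightarrow>\<^sub>0 'a::comm_ring_1"
  assumes "poly_vars_in {1..d} P"
  shows "N d (eval_power_sums d P) = sum_of_coeffs P"
proof -
  define p :: "((nat \<Rightarrow>\<^sub>0 nat) \<Rightarrow>\<^sub>0 'a) \<Rightarrow> 'a poly" where
    "p Q = (\<Sum>m\<in>Poly_Mapping.keys Q.
       Polynomial.monom (Poly_Mapping.lookup Q m) (\<Sum>s=1..d. s * Poly_Mapping.lookup m s))" for Q
  have val: "poly (p Q) 1 = sum_of_coeffs Q" for Q
    by (simp add: p_def sum_of_coeffs_def poly_sum poly_monom)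
  define Q where "Q = (SOME Q. poly_vars_in {1..d} Q \<and> eval_power_sums d Q = eval_power_sums d P)"
  have "eval_power_sums d Q = eval_power_sums d P"
    unfolding Q_def by (rule someI2 [of _ P]) (use assms in auto)
  then have "fps_of_poly (p Q) = fps_of_poly (p P)"
    using first_variable_eval_power_sums [of d Q] first_variable_eval_power_sums [of d P]
    by (simp add: p_def)
  then have "sum_of_coeffs Q = sum_of_coeffs P"
    by (simp add: fps_of_poly_eq_iff val [symmetric])
  then show ?thesis by (simp add: N_def Q_def)
qed

text \<open>An exponent vector in the indeterminates that stand for the power sums, not in the
  variables x_i.\<close>

definition cycle_type :: "nat \<Rightarrow> (nat \<Rightarrow> nat) \<Rightarrow> nat \<Rightarrow>\<^sub>0 nat" where
  "cycle_type d \<sigma> = (\<Sum>s=1..d. Poly_Mapping.single s (cycle_count d s \<sigma>))"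

lemma lookup_cycle_type:
  "Poly_Mapping.lookup (cycle_type d \<sigma>) s = (if s \<in> {1..d} then cycle_count d s \<sigma> else 0)"
  by (simp add: cycle_type_def lookup_sum lookup_single when_def)

lemma N_ch:
  fixes u :: "(nat \<Rightarrow> nat) \<Rightarrow> 'a::field"
  shows "N d (ch d u) = inverse (of_nat (fact d)) * (\<Sum>\<sigma>\<in>carrier (sym_group d). u \<sigma>)"
proof -
  define S where "S = carrier (sym_group d)"
  have fin: "finite S"
    by (simp add: S_def sym_group_def finite_permutations)
  define c where "c \<sigma> = inverse (of_nat (fact d)) * u \<sigma>" for \<sigma>
  define P where "P = (\<Sum>\<sigma>\<in>S. Poly_Mapping.single (cycle_type d \<sigma>) (c \<sigma>))"
  let ?T = "cycle_type d ` S"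
  have lookup: "Poly_Mapping.lookup P m = (\<Sum>\<sigma>\<in>S. if cycle_type d \<sigma> = m then c \<sigma> else 0)" for m
    by (simp add: P_def lookup_sum lookup_single when_def)
  \<comment> \<open>Only an inclusion: the contributions of permutations with the same cycle type
    are added and may cancel. The sums over the keys are therefore extended to \<open>?T\<close>
    below.\<close>
  have keys: "Poly_Mapping.keys P \<subseteq> ?T"
  proof
    fix m assume "m \<in> Poly_Mapping.keys P"
    then have "(\<Sum>\<sigma>\<in>S. if cycle_type d \<sigma> = m then c \<sigma> else 0) \<noteq> 0"
      by (simp add: in_keys_iff lookup)
    then obtain \<sigma> where "\<sigma> \<in> S" "cycle_type d \<sigma> = m"
      by (rule sum.not_neutral_contains_not_neutral) (metis (mono_tags))
    then show "m \<in> ?T" by blast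
  qed
  have "poly_vars_in {1..d} P"
    unfolding poly_vars_in_def
  proof (intro ballI subsetI)
    fix m s assume "m \<in> Poly_Mapping.keys P" and s: "s \<in> Poly_Mapping.keys m"
    then obtain \<sigma> where "m = cycle_type d \<sigma>" using keys by blast
    then show "s \<in> {1..d}" using s by (auto simp: in_keys_iff lookup_cycle_type split: if_splits)
  qed
  moreover have "eval_power_sums d P = ch d u"
  proof -
    let ?X = "\<lambda>m. \<Prod>s=1..d. power_sum s ^ Poly_Mapping.lookup m s :: 'a mseries"
    have X: "?X (cycle_type d \<sigma>) = cycle_monomial d \<sigma>" for \<sigma>
      by (simp add: cycle_monomial_def lookup_cycle_type)
    have if_mscale: "mscale (if b then x else 0) f = (if b then mscale x f else 0)" for b x and f :: "'a mseries"
      by (auto intro: mseries_eqI)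
    have "eval_power_sums d P = (\<Sum>m\<in>?T. mscale (Poly_Mapping.lookup P m) (?X m))"
      unfolding eval_power_sums_def
      by (rule sum.mono_neutral_left) (use fin keys in \<open>auto simp: in_keys_iff intro: mseries_eqI\<close>)
    also have "\<dots> = (\<Sum>\<sigma>\<in>S. \<Sum>m\<in>?T. if cycle_type d \<sigma> = m then mscale (c \<sigma>) (?X m) else 0)"
      unfolding lookup mscale_sum_left if_mscale by (rule sum.swap)
    also have "\<dots> = (\<Sum>\<sigma>\<in>S. mscale (c \<sigma>) (?X (cycle_type d \<sigma>)))"
      using fin by (intro sum.cong) (auto simp: sum.delta)
    finally show ?thesis
      by (simp only: X) (simp add: ch_def S_def c_def mscale_sum_right mscale_mscale)
  qed
  moreover have "sum_of_coeffs P = (\<Sum>\<sigma>\<in>S. c \<sigma>)"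
  proof -
    have "sum_of_coeffs P = (\<Sum>m\<in>?T. Poly_Mapping.lookup P m)"
      unfolding sum_of_coeffs_def
      by (rule sum.mono_neutral_left) (use fin keys in \<open>auto simp: in_keys_iff\<close>)
    also have "\<dots> = (\<Sum>\<sigma>\<in>S. \<Sum>m\<in>?T. if cycle_type d \<sigma> = m then c \<sigma> else 0)"
      unfolding lookup by (rule sum.swap)
    also have "\<dots> = (\<Sum>\<sigma>\<in>S. c \<sigma>)"
      using fin by (intro sum.cong) (auto simp: sum.delta)
    finally show ?thesis .
  qed
  ultimately show ?thesis
    using N_eval_power_sums [of d P] by (simp add: S_def c_def sum_distrib_left)
qed

text \<open>Expanding the product picks one variable \<open>f C\<close> from each factor. It is
  enough to know that the coefficient is a natural number and when it is positive: in characteristic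
  zero a sum of such coefficients vanishes only if each of them does.\<close>

lemma prod_power_sum_coefficient:
  fixes c :: "'b \<Rightarrow> nat"
  assumes "finite B"
  shows "\<exists>n. mcoeff (\<Prod>C\<in>B. power_sum (c C) :: 'a::comm_ring_1 mseries) m = of_nat n \<and>
    (n > 0 \<longleftrightarrow> (\<exists>f. (\<Sum>C\<in>B. Poly_Mapping.single (f C) (c C)) = m))"
  using assms
proof (induction B arbitrary: m rule: finite_induct)
  case empty
  show ?case by (rule exI [of _ "if m = 0 then 1 else 0"]) (auto simp: one_mseries.rep_eq)
next
  case (insert x B)
  then obtain n where n: "\<And>m. mcoeff (\<Prod>C\<in>B. power_sum (c C) :: 'a mseries) m = of_nat (n m)"
    and pos: "\<And>m. n m > 0 \<longleftrightarrow> (\<exists>f. (\<Sum>C\<in>B. Poly_Mapping.single (f C) (c C)) = m)"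
    by metis
  \<comment> \<open>The new factor contributes a power of a single variable, and the complementary
    monomial \<open>b\<close> has to come from the old factors.\<close>
  define k where "k = (\<Sum>(a, b)\<in>msplit m. if \<exists>i. a = Poly_Mapping.single i (c x) then n b else 0)"
  have "mcoeff (\<Prod>C\<in>insert x B. power_sum (c C) :: 'a mseries) m = of_nat k"
    using insert.hyps
    by (auto simp: times_mseries.rep_eq n power_sum.rep_eq k_def of_nat_sum intro!: sum.cong)
  moreover have "k > 0 \<longleftrightarrow> (\<exists>f. (\<Sum>C\<in>insert x B. Poly_Mapping.single (f C) (c C)) = m)"
  proof
    assume "k > 0"
    then have "(\<Sum>(a, b)\<in>msplit m. if \<exists>i. a = Poly_Mapping.single i (c x) then n b else 0) \<noteq> 0"
      unfolding k_def by (rule gr_implies_not0)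
    then obtain p where "p \<in> msplit m"
      "(case p of (a, b) \<Rightarrow> if \<exists>i. a = Poly_Mapping.single i (c x) then n b else 0) \<noteq> 0"
      by (rule sum.not_neutral_contains_not_neutral) blast
    then obtain a b where ab: "(a, b) \<in> msplit m" "(if \<exists>i. a = Poly_Mapping.single i (c x) then n b else 0) \<noteq> 0"
      by (cases p) simp
    then obtain i where i: "a = Poly_Mapping.single i (c x)" and "n b > 0"
      by (auto split: if_splits)
    then obtain f where f: "(\<Sum>C\<in>B. Poly_Mapping.single (f C) (c C)) = b" using pos by blast
    have "(\<Sum>C\<in>B. Poly_Mapping.single ((f(x := i)) C) (c C)) = b"
      unfolding f [symmetric] using insert.hyps by (intro sum.cong) auto
    then have "(\<Sum>C\<in>insert x B. Poly_Mapping.single ((f(x := i)) C) (c C)) = m"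
      using insert.hyps ab i by (simp add: msplit_def)
    then show "\<exists>f. (\<Sum>C\<in>insert x B. Poly_Mapping.single (f C) (c C)) = m" by blast
  next
    assume "\<exists>f. (\<Sum>C\<in>insert x B. Poly_Mapping.single (f C) (c C)) = m"
    then obtain f where f: "(\<Sum>C\<in>insert x B. Poly_Mapping.single (f C) (c C)) = m" ..
    define b where "b = (\<Sum>C\<in>B. Poly_Mapping.single (f C) (c C))"
    have "(Poly_Mapping.single (f x) (c x), b) \<in> msplit m"
      using f insert.hyps by (simp add: msplit_def b_def)
    moreover have "n b > 0" using pos b_def by blast
    ultimately show "k > 0"
      unfolding k_def by (intro sum_pos2 [OF finite_msplit]) auto
  qed
  ultimately show ?case by blast
qed

section \<open>Permutations with the same cycle type\<close>

lemma orbit_eq_orbit: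
  assumes "p permutes S" "finite S" "y \<in> orbit p x"
  shows "orbit p y = orbit p x"
  using orbit_cyclic_eq3 [OF cyclic_on_orbit [OF assms(1,2)] assms(3)] .

lemma self_in_orbit:
  assumes "p permutes S" "finite S"
  shows "x \<in> orbit p x"
  using assms by (intro permutation_self_in_orbit) (auto simp: permutation_permutes)

text \<open>Which iterates agree depends on the cycle of \<open>x\<close> only through its length.
  This allows cycles of equal length to be matched point by point.\<close>

lemma funpow_eq_iff:
  assumes p: "p permutes S" "finite S"
  shows "(p ^^ i) x = (p ^^ j) x \<longleftrightarrow> i mod card (orbit p x) = j mod card (orbit p x)"
proof -
  have self: "x \<in> orbit p x" using p by (rule self_in_orbit)
  define n where "n = funpow_dist1 p x x"
  have inj: "inj_on (\<lambda>k. (p ^^ k) x) {0..<n}"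
    unfolding n_def by (rule inj_on_funpow_dist1 [OF self])
  have card: "card (orbit p x) = n"
    using orbit_conv_funpow_dist1 [OF self] card_image [OF inj] by (simp add: n_def)
  have "(p ^^ n) x = x" unfolding n_def by (rule funpow_dist1_prop [OF self])
  then have "(p ^^ (k mod n)) x = (p ^^ k) x" for k by (rule funpow_mod_eq)
  moreover have "k mod n \<in> {0..<n}" for k by (simp add: n_def)
  ultimately show ?thesis using inj unfolding card by (metis inj_onD)
qed

text \<open>Fix a base point in every cycle and send the i-th iterate of the base point of C under
  \<sigma> to the i-th iterate of the base point of \<beta> C under \<tau>. Equal cycle lengths make
  this well defined and injective.\<close>

lemma conjugate_permutations:
  assumes \<sigma>: "\<sigma> permutes S" and \<tau>: "\<tau> permutes S" and fin: "finite S"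
    and bij: "bij_betw \<beta> (orbit \<sigma> ` S) (orbit \<tau> ` S)"
    and card: "\<And>C. C \<in> orbit \<sigma> ` S \<Longrightarrow> card (\<beta> C) = card C"
  obtains \<pi> where "\<pi> permutes S" "\<tau> = \<pi> \<circ> \<sigma> \<circ> Hilbert_Choice.inv \<pi>"
proof -
  define base where "base C = (SOME x. x \<in> C)" for C :: "'a set"
  have base: "base (orbit p x) \<in> orbit p x" for p x
    unfolding base_def using orbit_nonempty [of p x] by (simp add: some_in_eq)
  \<comment> \<open>Any exponent leading from the base point to \<open>x\<close> will do: by
    \<open>\<tau>_eq_iff\<close> below, \<pi> does not depend on it.\<close>
  define n where "n x = (SOME n. (\<sigma> ^^ n) (base (orbit \<sigma> x)) = x)" for x
  have n: "(\<sigma> ^^ n x) (base (orbit \<sigma> x)) = x" for x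
  proof -
    have "x \<in> orbit \<sigma> (base (orbit \<sigma> x))"
      using orbit_eq_orbit [OF \<sigma> fin base] self_in_orbit [OF \<sigma> fin] by simp
    then have "(\<sigma> ^^ funpow_dist \<sigma> (base (orbit \<sigma> x)) x) (base (orbit \<sigma> x)) = x"
      by (rule funpow_dist_prop)
    then show ?thesis unfolding n_def by (rule someI)
  qed
  define \<pi> where "\<pi> x = (if x \<in> S then (\<tau> ^^ n x) (base (\<beta> (orbit \<sigma> x))) else x)" for x
  have \<beta>: "orbit \<tau> (base (\<beta> (orbit \<sigma> x))) = \<beta> (orbit \<sigma> x)" "base (\<beta> (orbit \<sigma> x)) \<in> S" if x: "x \<in> S" for x
  proof -
    obtain y where y: "y \<in> S" "\<beta> (orbit \<sigma> x) = orbit \<tau> y"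
      using bij_betwE [OF bij] x by blast
    show "orbit \<tau> (base (\<beta> (orbit \<sigma> x))) = \<beta> (orbit \<sigma> x)"
      unfolding y by (rule orbit_eq_orbit [OF \<tau> fin base])
    show "base (\<beta> (orbit \<sigma> x)) \<in> S"
      unfolding y using permutes_orbit_subset [OF \<tau> y(1)] base by blast
  qed
  have \<pi>_orbit: "\<pi> x \<in> \<beta> (orbit \<sigma> x)" if x: "x \<in> S" for x
    using funpow_in_orbit [OF self_in_orbit [OF \<tau> fin], of "n x" "base (\<beta> (orbit \<sigma> x))"] \<beta>(1) [OF x] x
    by (simp add: \<pi>_def)
  have \<tau>_eq_iff: "(\<tau> ^^ i) (base (\<beta> (orbit \<sigma> x))) = (\<tau> ^^ j) (base (\<beta> (orbit \<sigma> x))) \<longleftrightarrow>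
      (\<sigma> ^^ i) (base (orbit \<sigma> x)) = (\<sigma> ^^ j) (base (orbit \<sigma> x))" if x: "x \<in> S" for x i j
    using card [of "orbit \<sigma> x"] x
    by (simp add: funpow_eq_iff [OF \<sigma> fin] funpow_eq_iff [OF \<tau> fin] \<beta> orbit_eq_orbit [OF \<sigma> fin base])
  have \<pi>S: "\<pi> x \<in> S" if x: "x \<in> S" for x
    using \<pi>_orbit [OF x] \<beta>(1) [OF x] permutes_orbit_subset [OF \<tau> \<beta>(2) [OF x]] by blast
  have inj: "inj_on \<pi> S"
  proof (rule inj_onI)
    fix x y assume xy: "x \<in> S" "y \<in> S" and eq: "\<pi> x = \<pi> y"
    have "\<beta> (orbit \<sigma> x) = \<beta> (orbit \<sigma> y)"
      using orbit_eq_orbit [OF \<tau> fin, of "\<pi> x"] \<pi>_orbit [OF xy(1)] \<pi>_orbit [OF xy(2)] \<beta>(1) xy eq by metis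
    then have orbits: "orbit \<sigma> x = orbit \<sigma> y"
      using bij xy by (auto simp: bij_betw_def dest: inj_onD)
    have "(\<tau> ^^ n x) (base (\<beta> (orbit \<sigma> x))) = (\<tau> ^^ n y) (base (\<beta> (orbit \<sigma> x)))"
      using eq xy orbits by (simp add: \<pi>_def)
    then show "x = y" using \<tau>_eq_iff [OF xy(1)] n [of x] n [of y] orbits by simp
  qed
  have "\<pi> ` S = S"
    using inj \<pi>S fin by (intro endo_inj_surj) auto
  with inj have permutes: "\<pi> permutes S"
    by (intro bij_imp_permutes) (auto simp: bij_betw_def \<pi>_def)
  have commute: "\<pi> (\<sigma> x) = \<tau> (\<pi> x)" for x
  proof (cases "x \<in> S")
    case True
    then have \<sigma>x: "\<sigma> x \<in> S" using \<sigma> by (simp add: permutes_in_image)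
    have orbits: "orbit \<sigma> (\<sigma> x) = orbit \<sigma> x"
      by (rule orbit_eq_orbit [OF \<sigma> fin]) (rule orbit.base)
    \<comment> \<open>The exponents n (\<sigma> x) and Suc (n x) may differ, but both lead from the
      base point to \<sigma> x, so the corresponding iterates of \<tau> agree as well.\<close>
    have "(\<sigma> ^^ n (\<sigma> x)) (base (orbit \<sigma> x)) = (\<sigma> ^^ Suc (n x)) (base (orbit \<sigma> x))"
      using n [of "\<sigma> x"] n [of x] orbits by simp
    then have "(\<tau> ^^ n (\<sigma> x)) (base (\<beta> (orbit \<sigma> x))) = (\<tau> ^^ Suc (n x)) (base (\<beta> (orbit \<sigma> x)))"
      using \<tau>_eq_iff [OF True] by blast
    then show ?thesis using True \<sigma>x orbits by (simp add: \<pi>_def)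
  next
    case False
    then show ?thesis using \<sigma> \<tau> by (simp add: \<pi>_def permutes_not_in)
  qed
  have "\<tau> = \<pi> \<circ> \<sigma> \<circ> Hilbert_Choice.inv \<pi>"
    by (rule ext) (simp add: commute permutes_inverses(1) [OF permutes])
  with permutes show ?thesis by (rule that)
qed

section \<open>The characteristic map\<close>

definition class_function :: "nat \<Rightarrow> ((nat \<Rightarrow> nat) \<Rightarrow> 'a::zero) \<Rightarrow> bool" where
  "class_function d u \<longleftrightarrow> (\<forall>\<sigma>. \<not> \<sigma> permutes {1..d} \<longrightarrow> u \<sigma> = 0) \<and>
     (\<forall>\<pi> \<sigma>. \<pi> permutes {1..d} \<longrightarrow> \<sigma> permutes {1..d} \<longrightarrow> u (\<pi> \<circ> \<sigma> \<circ> Hilbert_Choice.inv \<pi>) = u \<sigma>)"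

lemma card_orbit_image:
  assumes \<sigma>: "\<sigma> permutes {1..d}" and C: "C \<in> orbit \<sigma> ` {1..d}"
  shows "card C \<in> {1..d}"
proof -
  have "C \<subseteq> {1..d}" "C \<noteq> {}"
    using C permutes_orbit_subset [OF \<sigma>] orbit_nonempty [of \<sigma>] by blast+
  then show ?thesis
    using card_mono [of "{1..d}" C] finite_subset [of C "{1..d}"] by (auto simp: Suc_le_eq card_gt_0_iff)
qed

text \<open>With one factor per cycle instead of one power per length, a variable can be chosen for
  each cycle separately.\<close>

lemma cycle_monomial_eq_prod:
  assumes "\<sigma> permutes {1..d}"
  shows "cycle_monomial d \<sigma> = (\<Prod>C\<in>orbit \<sigma> ` {1..d}. power_sum (card C))"
proof -
  have "(\<Prod>C\<in>orbit \<sigma> ` {1..d}. power_sum (card C) :: 'a mseries) =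
      (\<Prod>s=1..d. \<Prod>C | C \<in> orbit \<sigma> ` {1..d} \<and> card C = s. power_sum (card C))"
    using card_orbit_image [OF assms] by (intro prod.group [symmetric]) blast+
  also have "\<dots> = (\<Prod>s=1..d. power_sum s ^ cycle_count d s \<sigma>)"
    unfolding cycle_count_def by (intro prod.cong) simp_all
  finally show ?thesis by (simp add: cycle_monomial_def)
qed

lemma lookup_sum_single:
  assumes "finite B" "inj_on f B" "C \<in> B"
  shows "Poly_Mapping.lookup (\<Sum>C\<in>B. Poly_Mapping.single (f C) (c C)) (f C) = c C"
proof -
  have "Poly_Mapping.lookup (\<Sum>C\<in>B. Poly_Mapping.single (f C) (c C)) (f C) =
      (\<Sum>D\<in>B. if D = C then c D else 0)"
    unfolding lookup_sum using assms(2,3)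
    by (intro sum.cong) (auto simp: lookup_single when_def dest: inj_onD)
  then show ?thesis using assms by simp
qed

text \<open>Natural exponents cannot cancel, so every variable used occurs in the monomial, also
  when \<open>f\<close> takes it several times.\<close>

lemma keys_sum_single:
  fixes c :: "'b \<Rightarrow> nat"
  assumes "finite B" "\<And>C. C \<in> B \<Longrightarrow> c C > 0"
  shows "Poly_Mapping.keys (\<Sum>C\<in>B. Poly_Mapping.single (f C) (c C)) = f ` B"
proof -
  have "Poly_Mapping.lookup (\<Sum>C\<in>B. Poly_Mapping.single (f C) (c C)) k \<noteq> 0 \<longleftrightarrow> k \<in> f ` B" for k
    using assms by (force simp: lookup_sum lookup_single when_def)
  then show ?thesis by (auto simp: in_keys_iff)
qed

text \<open>
  Take \<open>\<sigma>\<close> with \<open>w \<sigma> \<noteq> 0\<close> and as many cycles as possible, and the monomial in which each cycle of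
  \<open>\<sigma>\<close> has its own variable, with the length of the cycle as exponent. A permutation whose cycle
  monomial contains it has at least as many cycles as \<open>\<sigma>\<close>, with equality only for the same cycle
  type.
\<close>

lemma class_function_eq_zeroI:
  fixes w :: "(nat \<Rightarrow> nat) \<Rightarrow> 'a::field_char_0"
  assumes w: "class_function d w"
    and zero: "(\<Sum>\<sigma>\<in>carrier (sym_group d). mscale (w \<sigma>) (cycle_monomial d \<sigma>)) = 0"
  shows "w \<sigma> = 0"
proof (rule ccontr)
  assume "w \<sigma> \<noteq> 0"
  define S where "S = {\<sigma>. \<sigma> permutes {1..d}}"
  define Orb where "Orb \<sigma> = orbit \<sigma> ` {1..d}" for \<sigma> :: "nat \<Rightarrow> nat"
  define T where "T = {\<sigma> \<in> S. w \<sigma> \<noteq> 0}"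
  have finS: "finite S" by (simp add: S_def finite_permutations)
  have finOrb: "finite (Orb \<tau>)" for \<tau> by (simp add: Orb_def)
  have "\<sigma> \<in> T" using \<open>w \<sigma> \<noteq> 0\<close> w by (auto simp: T_def S_def class_function_def)
  moreover have "finite T" using finS by (simp add: T_def)
  ultimately have "Max ((\<lambda>\<tau>. card (Orb \<tau>)) ` T) \<in> (\<lambda>\<tau>. card (Orb \<tau>)) ` T"
    by (intro Max_in) auto
  then obtain \<sigma> where \<sigma>: "\<sigma> \<in> T" and "card (Orb \<sigma>) = Max ((\<lambda>\<tau>. card (Orb \<tau>)) ` T)"
    by auto
  then have max: "card (Orb \<tau>) \<le> card (Orb \<sigma>)" if "\<tau> \<in> T" for \<tau>
    using \<open>finite T\<close> that by simp
  obtain f :: "nat set \<Rightarrow> nat" where f: "inj_on f (Orb \<sigma>)"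
    using finite_imp_inj_to_nat_seg [OF finOrb] that by blast
  define m where "m = (\<Sum>C\<in>Orb \<sigma>. Poly_Mapping.single (f C) (card C))"
  have pos: "card C > 0" if "\<tau> \<in> S" "C \<in> Orb \<tau>" for \<tau> C
    using card_orbit_image [of \<tau> d C] that by (auto simp: S_def Orb_def)
  obtain n where n: "\<And>\<tau>. mcoeff (\<Prod>C\<in>Orb \<tau>. power_sum (card C) :: 'a mseries) m = of_nat (n \<tau>)"
    and n_pos: "\<And>\<tau>. n \<tau> > 0 \<longleftrightarrow> (\<exists>g. (\<Sum>C\<in>Orb \<tau>. Poly_Mapping.single (g C) (card C)) = m)"
  proof -
    have "\<forall>\<tau>. \<exists>n. mcoeff (\<Prod>C\<in>Orb \<tau>. power_sum (card C) :: 'a mseries) m = of_nat n \<and>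
      (n > 0 \<longleftrightarrow> (\<exists>g. (\<Sum>C\<in>Orb \<tau>. Poly_Mapping.single (g C) (card C)) = m))"
      using prod_power_sum_coefficient [OF finOrb] by blast
    from choice [OF this] show ?thesis using that by blast
  qed
  have same: "w \<tau> = w \<sigma>" if \<tau>: "\<tau> \<in> T" and "n \<tau> > 0" for \<tau>
  proof -
    obtain g where g: "(\<Sum>C\<in>Orb \<tau>. Poly_Mapping.single (g C) (card C)) = m"
      using \<open>n \<tau> > 0\<close> n_pos by blast
    have S: "\<sigma> \<in> S" "\<tau> \<in> S" using \<sigma> \<tau> by (auto simp: T_def)
    have image: "g ` Orb \<tau> = f ` Orb \<sigma>"
      using keys_sum_single [of "Orb \<tau>" card g, OF finOrb pos]
        keys_sum_single [of "Orb \<sigma>" card f, OF finOrb pos] S g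
      by (simp add: m_def)
    \<comment> \<open>\<open>m\<close> contains as many variables as \<sigma> has cycles. By
      maximality \<tau> has no more cycles than that, so \<open>g\<close> gives distinct variables
      to distinct cycles, and the exponents of \<open>m\<close> are the cycle lengths of both
      permutations.\<close>
    have "card (Orb \<tau>) \<le> card (g ` Orb \<tau>)"
      using max [OF \<tau>] card_image [OF f] by (simp add: image)
    then have inj: "inj_on g (Orb \<tau>)"
      using card_image_le [OF finOrb, of g \<tau>] by (intro eq_card_imp_inj_on [OF finOrb]) simp
    define \<beta> where "\<beta> C = inv_into (Orb \<tau>) g (f C)" for C
    have "bij_betw \<beta> (Orb \<sigma>) (Orb \<tau>)"
    proof -
      have "bij_betw f (Orb \<sigma>) (g ` Orb \<tau>)" using f by (simp add: bij_betw_def image)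
      moreover have "bij_betw (inv_into (Orb \<tau>) g) (g ` Orb \<tau>) (Orb \<tau>)"
        using inj by (intro bij_betw_inv_into) (simp add: bij_betw_def)
      ultimately have "bij_betw (inv_into (Orb \<tau>) g \<circ> f) (Orb \<sigma>) (Orb \<tau>)" by (rule bij_betw_trans)
      then show ?thesis by (simp add: \<beta>_def [abs_def] comp_def)
    qed
    moreover have "card (\<beta> C) = card C" if C: "C \<in> Orb \<sigma>" for C
    proof -
      have "f C \<in> g ` Orb \<tau>" using C image by blast
      then have \<beta>C: "\<beta> C \<in> Orb \<tau>" "g (\<beta> C) = f C"
        by (simp_all add: \<beta>_def inv_into_into f_inv_into_f)
      have "card (\<beta> C) = Poly_Mapping.lookup m (g (\<beta> C))"
        using lookup_sum_single [OF finOrb inj \<beta>C(1), of card] by (simp add: g)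
      also have "\<dots> = card C"
        using lookup_sum_single [OF finOrb f C, of card] by (simp add: m_def \<beta>C)
      finally show ?thesis .
    qed
    ultimately obtain \<pi> where "\<pi> permutes {1..d}" "\<tau> = \<pi> \<circ> \<sigma> \<circ> Hilbert_Choice.inv \<pi>"
      using conjugate_permutations [of \<sigma> "{1..d}" \<tau> \<beta>] S unfolding S_def Orb_def by auto
    then show ?thesis using w S by (auto simp: class_function_def S_def)
  qed
  have "0 = mcoeff (\<Sum>\<tau>\<in>S. mscale (w \<tau>) (cycle_monomial d \<tau>)) m"
    using zero by (simp add: S_def sym_group_def)
  also have "\<dots> = (\<Sum>\<tau>\<in>S. w \<tau> * of_nat (n \<tau>))"
    unfolding mcoeff_sum
    by (intro sum.cong) (simp_all add: cycle_monomial_eq_prod n [symmetric] S_def Orb_def)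
  \<comment> \<open>Each \<tau> in \<open>T\<close> that contributes to the coefficient of
    \<open>m\<close> is conjugate to \<sigma>, so w \<sigma> factors out. A natural number remains,
    and it is positive because \<sigma> itself contributes.\<close>
  also have "\<dots> = (\<Sum>\<tau>\<in>T. w \<sigma> * of_nat (n \<tau>))"
  proof (rule sum.mono_neutral_cong_right [OF finS])
    show "w \<tau> * of_nat (n \<tau>) = w \<sigma> * of_nat (n \<tau>)" if "\<tau> \<in> T" for \<tau>
      using same [OF that] by (cases "n \<tau> = 0") simp_all
  qed (auto simp: T_def)
  also have "\<dots> = w \<sigma> * of_nat (\<Sum>\<tau>\<in>T. n \<tau>)"
    by (simp add: sum_distrib_left)
  finally have "w \<sigma> * of_nat (\<Sum>\<tau>\<in>T. n \<tau>) = 0" ..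
  moreover have "w \<sigma> \<noteq> 0" using \<sigma> by (simp add: T_def)
  ultimately have "(\<Sum>\<tau>\<in>T. n \<tau>) = 0" by (simp del: of_nat_sum)
  then have "n \<sigma> = 0" using \<sigma> \<open>finite T\<close> by simp
  moreover have "n \<sigma> > 0" using n_pos m_def by blast
  ultimately show False by simp
qed

lemma ch_inj:
  fixes u v :: "(nat \<Rightarrow> nat) \<Rightarrow> 'a::field_char_0"
  assumes "class_function d u" "class_function d v" "ch d u = ch d v"
  shows "u = v"
proof
  fix \<sigma>
  let ?w = "\<lambda>\<sigma>. u \<sigma> - v \<sigma>"
  let ?S = "\<lambda>w. \<Sum>\<sigma>\<in>carrier (sym_group d). mscale (w \<sigma>) (cycle_monomial d \<sigma>) :: 'a mseries"
  have "mscale (of_nat (fact d)) (ch d u) = ?S u" "mscale (of_nat (fact d)) (ch d v) = ?S v"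
    unfolding ch_def mscale_mscale by (auto intro!: mseries_eqI)
  then have "?S u = ?S v" using assms(3) by simp
  then have "mcoeff (?S u) m = mcoeff (?S v) m" for m by simp
  then have "?S ?w = 0"
    by (intro mseries_eqI) (simp add: mcoeff_sum sum_subtractf left_diff_distrib)
  moreover have "class_function d ?w" using assms(1,2) by (auto simp: class_function_def)
  ultimately have "?w \<sigma> = 0" by (rule class_function_eq_zeroI [rotated])
  then show "u \<sigma> = v \<sigma>" by simp
qed

section \<open>Matrix representations given by kernels\<close>

text \<open>A matrix representation indexed by an arbitrary finite set, so that a transversal or a
  product of index sets can be used without numbering it. The two equations already force the
  matrices to be invertible.\<close>

definition representation_kernel ::
    "nat \<Rightarrow> 'i set \<Rightarrow> ((nat \<Rightarrow> nat) \<Rightarrow> 'i \<Rightarrow> 'i \<Rightarrow> 'a::field) \<Rightarrow> bool" where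
  "representation_kernel d I A \<longleftrightarrow> finite I \<and>
     (\<forall>i\<in>I. \<forall>j\<in>I. A id i j = (if i = j then 1 else 0)) \<and>
     (\<forall>\<sigma> \<tau>. \<sigma> permutes {1..d} \<longrightarrow> \<tau> permutes {1..d} \<longrightarrow>
        (\<forall>i\<in>I. \<forall>j\<in>I. A (\<sigma> \<circ> \<tau>) i j = (\<Sum>k\<in>I. A \<sigma> i k * A \<tau> k j)))"

definition kernel_character ::
    "nat \<Rightarrow> 'i set \<Rightarrow> ((nat \<Rightarrow> nat) \<Rightarrow> 'i \<Rightarrow> 'i \<Rightarrow> 'a::field) \<Rightarrow> (nat \<Rightarrow> nat) \<Rightarrow> 'a" where
  "kernel_character d I A \<sigma> = (if \<sigma> permutes {1..d} then \<Sum>i\<in>I. A \<sigma> i i else 0)"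

lemma representation_kernelI:
  assumes "finite I"
    and "\<And>i j. i \<in> I \<Longrightarrow> j \<in> I \<Longrightarrow> A id i j = (if i = j then 1 else 0)"
    and "\<And>\<sigma> \<tau> i j. \<sigma> permutes {1..d} \<Longrightarrow> \<tau> permutes {1..d} \<Longrightarrow> i \<in> I \<Longrightarrow> j \<in> I \<Longrightarrow>
      A (\<sigma> \<circ> \<tau>) i j = (\<Sum>k\<in>I. A \<sigma> i k * A \<tau> k j)"
  shows "representation_kernel d I A"
  using assms by (simp add: representation_kernel_def)

lemma representation_kernelD:
  assumes "representation_kernel d I A"
  shows "finite I" "i \<in> I \<Longrightarrow> j \<in> I \<Longrightarrow> A id i j = (if i = j then 1 else 0)"
    "\<sigma> permutes {1..d} \<Longrightarrow> \<tau> permutes {1..d} \<Longrightarrow> i \<in> I \<Longrightarrow> j \<in> I \<Longrightarrow>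
      A (\<sigma> \<circ> \<tau>) i j = (\<Sum>k\<in>I. A \<sigma> i k * A \<tau> k j)"
  using assms by (simp_all add: representation_kernel_def)

text \<open>Numbering the index set gives actual matrices, and the matrix of the inverse permutation
  is the inverse that membership in \<open>Units\<close> asks for.\<close>

lemma kernel_character_in_sym_characters:
  fixes A :: "(nat \<Rightarrow> nat) \<Rightarrow> 'i \<Rightarrow> 'i \<Rightarrow> 'a::field"
  assumes "representation_kernel d I A"
  shows "kernel_character d I A \<in> sym_characters d"
proof -
  note fin = representation_kernelD(1) [OF assms] and one = representation_kernelD(2) [OF assms]
    and mult = representation_kernelD(3) [OF assms]
  define n where "n = card I"
  obtain e where e: "bij_betw e {0..<n} I"
    using ex_bij_betw_nat_finite [OF fin] by (auto simp: n_def)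
  have eI: "e i \<in> I" if "i < n" for i using bij_betwE [OF e] that by auto
  have e_eq: "e i = e j \<longleftrightarrow> i = j" if "i < n" "j < n" for i j
    using bij_betw_imp_inj_on [OF e] that by (auto dest: inj_onD)
  define \<rho> where "\<rho> \<sigma> = mat n n (\<lambda>(i, j). A \<sigma> (e i) (e j))" for \<sigma>
  have \<rho>_mult: "\<rho> (\<sigma> \<circ> \<tau>) = \<rho> \<sigma> * \<rho> \<tau>" if "\<sigma> permutes {1..d}" "\<tau> permutes {1..d}" for \<sigma> \<tau>
  proof (rule eq_matI)
    fix i j assume "i < dim_row (\<rho> \<sigma> * \<rho> \<tau>)" "j < dim_col (\<rho> \<sigma> * \<rho> \<tau>)"
    then have ij: "i < n" "j < n" by (simp_all add: \<rho>_def)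
    have "A (\<sigma> \<circ> \<tau>) (e i) (e j) = (\<Sum>k\<in>{0..<n}. A \<sigma> (e i) (e k) * A \<tau> (e k) (e j))"
      using mult [OF that eI [OF ij(1)] eI [OF ij(2)]]
        sum.reindex_bij_betw [OF e, of "\<lambda>k. A \<sigma> (e i) k * A \<tau> k (e j)"] by simp
    then show "\<rho> (\<sigma> \<circ> \<tau>) $$ (i, j) = (\<rho> \<sigma> * \<rho> \<tau>) $$ (i, j)"
      using ij by (simp add: \<rho>_def scalar_prod_def)
  qed (simp_all add: \<rho>_def)
  have \<rho>_one: "\<rho> id = 1\<^sub>m n"
    by (rule eq_matI) (auto simp: \<rho>_def one eI e_eq)
  have \<rho>_carrier: "\<rho> \<sigma> \<in> carrier_mat n n" for \<sigma> by (simp add: \<rho>_def)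
  have "\<rho> \<sigma> \<in> Units (ring_mat TYPE('a) n ())" if \<sigma>: "\<sigma> permutes {1..d}" for \<sigma>
  proof -
    have "\<rho> (Hilbert_Choice.inv \<sigma>) * \<rho> \<sigma> = 1\<^sub>m n" "\<rho> \<sigma> * \<rho> (Hilbert_Choice.inv \<sigma>) = 1\<^sub>m n"
      using \<rho>_mult [OF permutes_inv [OF \<sigma>] \<sigma>] \<rho>_mult [OF \<sigma> permutes_inv [OF \<sigma>]]
      by (simp_all add: permutes_inv_o [OF \<sigma>] \<rho>_one)
    then show ?thesis using \<rho>_carrier by (auto simp: Units_def ring_mat_def)
  qed
  then have "\<rho> \<in> hom (sym_group d) (units_of (ring_mat TYPE('a) n ()))"
    using \<rho>_mult by (auto simp: hom_def sym_group_def units_of_def ring_mat_def)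
  moreover have "mat_trace (\<rho> \<sigma>) = (\<Sum>i\<in>I. A \<sigma> i i)" for \<sigma>
  proof -
    have "mat_trace (\<rho> \<sigma>) = (\<Sum>i\<in>{0..<n}. A \<sigma> (e i) (e i))"
      unfolding mat_trace_def by (rule sum.cong) (auto simp: \<rho>_def)
    also have "\<dots> = (\<Sum>i\<in>I. A \<sigma> i i)" by (rule sum.reindex_bij_betw [OF e])
    finally show ?thesis .
  qed
  ultimately show ?thesis
    unfolding sym_characters_def sym_group_carrier kernel_character_def [abs_def]
    by (intro CollectI exI [of _ \<rho>] exI [of _ n]) (simp cong: if_cong)
qed

lemma sym_charactersE:
  fixes u :: "(nat \<Rightarrow> nat) \<Rightarrow> 'a::field"
  assumes "u \<in> sym_characters d"
  obtains n :: nat and A where "representation_kernel d {0..<n} A" "u = kernel_character d {0..<n} A"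
proof -
  obtain \<rho> n where \<rho>: "\<rho> \<in> hom (sym_group d) (units_of (ring_mat TYPE('a) n ()))"
    and u: "u = (\<lambda>\<sigma>. if \<sigma> permutes {1..d} then mat_trace (\<rho> \<sigma>) else 0)"
    using assms unfolding sym_characters_def sym_group_carrier by blast
  interpret mat: ring "ring_mat TYPE('a) n ()" by (rule ring_mat)
  interpret group_hom "sym_group d" "units_of (ring_mat TYPE('a) n ())" \<rho>
    by (intro group_hom.intro group_hom_axioms.intro sym_group_is_group mat.units_group \<rho>)
  have carrier: "\<rho> \<sigma> \<in> carrier_mat n n" if "\<sigma> permutes {1..d}" for \<sigma>
    using hom_closed [of \<sigma>] that by (auto simp: sym_group_def units_of_def Units_def ring_mat_def)
  have mult: "\<rho> (\<sigma> \<circ> \<tau>) = \<rho> \<sigma> * \<rho> \<tau>" if "\<sigma> permutes {1..d}" "\<tau> permutes {1..d}" for \<sigma> \<tau>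
    using hom_mult [of \<sigma> \<tau>] that by (simp add: sym_group_def units_of_def ring_mat_def)
  have one: "\<rho> id = 1\<^sub>m n"
    using hom_one by (simp add: sym_group_def units_of_def ring_mat_def)
  show ?thesis
  proof (rule that [of n "\<lambda>\<sigma> i j. \<rho> \<sigma> $$ (i, j)"])
    show "representation_kernel d {0..<n} (\<lambda>\<sigma> i j. \<rho> \<sigma> $$ (i, j))"
    proof (rule representation_kernelI)
      fix \<sigma> \<tau> i j
      assume \<sigma>\<tau>: "\<sigma> permutes {1..d}" "\<tau> permutes {1..d}" and "i \<in> {0..<n}" "j \<in> {0..<n}"
      then show "\<rho> (\<sigma> \<circ> \<tau>) $$ (i, j) = (\<Sum>k\<in>{0..<n}. \<rho> \<sigma> $$ (i, k) * \<rho> \<tau> $$ (k, j))"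
        using carrier [OF \<sigma>\<tau>(1)] carrier [OF \<sigma>\<tau>(2)] by (simp add: mult scalar_prod_def)
    qed (auto simp: one)
    show "u = kernel_character d {0..<n} (\<lambda>\<sigma> i j. \<rho> \<sigma> $$ (i, j))"
    proof
      fix \<sigma> show "u \<sigma> = kernel_character d {0..<n} (\<lambda>\<sigma> i j. \<rho> \<sigma> $$ (i, j)) \<sigma>"
        using carrier [of \<sigma>]
        by (cases "\<sigma> permutes {1..d}") (auto simp: u kernel_character_def mat_trace_def lessThan_atLeast0)
    qed
  qed
qed

text \<open>The trace of a product of two matrices does not depend on their order; this is applied
  to the matrices of \<pi> \<circ> \<sigma> and of the inverse of \<pi>.\<close>

lemma class_function_sym_character:
  assumes "u \<in> sym_characters d"
  shows "class_function d u"
proof -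
  obtain n :: nat and A where A: "representation_kernel d {0..<n} A" and u: "u = kernel_character d {0..<n} A"
    using assms by (rule sym_charactersE)
  note mult = representation_kernelD(3) [OF A]
  have trace: "(\<Sum>i\<in>{0..<n}. A (\<sigma> \<circ> \<tau>) i i) = (\<Sum>i\<in>{0..<n}. A (\<tau> \<circ> \<sigma>) i i)"
    if "\<sigma> permutes {1..d}" "\<tau> permutes {1..d}" for \<sigma> \<tau>
  proof -
    have "(\<Sum>i\<in>{0..<n}. A (\<sigma> \<circ> \<tau>) i i) = (\<Sum>i\<in>{0..<n}. \<Sum>k\<in>{0..<n}. A \<sigma> i k * A \<tau> k i)"
      using that by (intro sum.cong refl mult)
    also have "\<dots> = (\<Sum>k\<in>{0..<n}. \<Sum>i\<in>{0..<n}. A \<tau> k i * A \<sigma> i k)"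
      by (subst sum.swap) (simp add: mult.commute)
    also have "\<dots> = (\<Sum>k\<in>{0..<n}. A (\<tau> \<circ> \<sigma>) k k)"
      using that by (intro sum.cong refl mult [symmetric])
    finally show ?thesis .
  qed
  show ?thesis
    unfolding class_function_def
  proof (intro conjI allI impI)
    fix \<pi> \<sigma> :: "nat \<Rightarrow> nat" assume \<pi>: "\<pi> permutes {1..d}" and \<sigma>: "\<sigma> permutes {1..d}"
    have "Hilbert_Choice.inv \<pi> \<circ> (\<pi> \<circ> \<sigma>) = \<sigma>"
      by (simp add: o_assoc permutes_inv_o [OF \<pi>])
    then show "u (\<pi> \<circ> \<sigma> \<circ> Hilbert_Choice.inv \<pi>) = u \<sigma>"
      using trace [OF permutes_compose [OF \<sigma> \<pi>] permutes_inv [OF \<pi>]] \<pi> \<sigma>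
      by (simp add: u kernel_character_def permutes_compose permutes_inv)
  qed (simp add: u kernel_character_def)
qed

text \<open>The tensor product of the two representations, with pairs as indices, has the product of
  the traces as its trace.\<close>

lemma sym_characters_mult:
  assumes "u \<in> sym_characters d" "v \<in> sym_characters d"
  shows "(\<lambda>\<sigma>. u \<sigma> * v \<sigma>) \<in> sym_characters d"
proof -
  obtain n :: nat and A where A: "representation_kernel d {0..<n} A" and u: "u = kernel_character d {0..<n} A"
    using assms(1) by (rule sym_charactersE)
  obtain m :: nat and B where B: "representation_kernel d {0..<m} B" and v: "v = kernel_character d {0..<m} B"
    using assms(2) by (rule sym_charactersE)
  let ?I = "{0..<n} \<times> {0..<m}"
  let ?C = "\<lambda>\<sigma> p q. A \<sigma> (fst p) (fst q) * B \<sigma> (snd p) (snd q)"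
  have tensor: "(\<Sum>p\<in>?I. f (fst p) * g (snd p)) = (\<Sum>i\<in>{0..<n}. f i) * (\<Sum>j\<in>{0..<m}. g j)"
    for f g :: "nat \<Rightarrow> 'a"
    by (simp add: sum_product sum.cartesian_product case_prod_unfold)
  have "representation_kernel d ?I ?C"
  proof (rule representation_kernelI)
    fix \<sigma> \<tau> p q assume *: "\<sigma> permutes {1..d}" "\<tau> permutes {1..d}" "p \<in> ?I" "q \<in> ?I"
    have "(\<Sum>r\<in>?I. ?C \<sigma> p r * ?C \<tau> r q) =
        (\<Sum>r\<in>?I. (A \<sigma> (fst p) (fst r) * A \<tau> (fst r) (fst q)) * (B \<sigma> (snd p) (snd r) * B \<tau> (snd r) (snd q)))"
      by (simp add: mult_ac)
    also have "\<dots> = ?C (\<sigma> \<circ> \<tau>) p q"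
      unfolding tensor [of "\<lambda>k. A \<sigma> (fst p) k * A \<tau> k (fst q)" "\<lambda>k. B \<sigma> (snd p) k * B \<tau> k (snd q)"]
      using * representation_kernelD(3) [OF A *(1,2)] representation_kernelD(3) [OF B *(1,2)]
      by (simp add: mem_Times_iff)
    finally show "?C (\<sigma> \<circ> \<tau>) p q = (\<Sum>r\<in>?I. ?C \<sigma> p r * ?C \<tau> r q)" ..
  qed (auto simp: representation_kernelD(2) [OF A] representation_kernelD(2) [OF B] split: if_splits)
  then have "kernel_character d ?I ?C \<in> sym_characters d"
    by (rule kernel_character_in_sym_characters)
  also have "kernel_character d ?I ?C = (\<lambda>\<sigma>. u \<sigma> * v \<sigma>)"
    unfolding u v kernel_character_def [abs_def]
    using tensor [of "\<lambda>i. A \<sigma> i i" "\<lambda>i. B \<sigma> i i" for \<sigma>] by auto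
  finally show ?thesis .
qed

text \<open>The representation of degree 0 has an empty index set. Subtracting its character
  exhibits any character as a generalized one.\<close>

lemma zero_in_sym_characters: "(\<lambda>_. 0 :: 'a::field) \<in> sym_characters d"
  using kernel_character_in_sym_characters [of d "{} :: nat set" "\<lambda>_ _ _. 0 :: 'a"]
  by (simp add: representation_kernel_def kernel_character_def [abs_def] cong: if_cong)

lemma sym_character_generalized: "u \<in> sym_characters d \<Longrightarrow> u \<in> generalized_characters d"
  using zero_in_sym_characters unfolding generalized_characters_def by force

lemma class_function_generalized_character:
  assumes "u \<in> generalized_characters d"
  shows "class_function d u"
proof -
  obtain v w where "class_function d v" "class_function d w" "u = (\<lambda>\<sigma>. v \<sigma> - w \<sigma>)"
    using assms class_function_sym_character unfolding generalized_characters_def by blast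
  then show ?thesis by (simp add: class_function_def)
qed

section \<open>The internal product as pointwise multiplication of characters\<close>

lemma ch_inv_ch:
  fixes u :: "(nat \<Rightarrow> nat) \<Rightarrow> 'a::field_char_0"
  assumes "u \<in> generalized_characters d"
  shows "ch_inv d (ch d u) = u"
  unfolding ch_inv_def
  by (rule inv_into_f_f)
    (use assms in \<open>auto intro!: inj_onI ch_inj class_function_generalized_character\<close>)

lemma internal_prod_ch:
  fixes u v :: "(nat \<Rightarrow> nat) \<Rightarrow> 'a::field_char_0"
  assumes "u \<in> sym_characters d" "v \<in> sym_characters d"
  shows "internal_prod d (ch d u) (ch d v) = ch d (\<lambda>\<sigma>. u \<sigma> * v \<sigma>)"
  using assms by (simp add: internal_prod_def ch_inv_ch sym_character_generalized)

lemma foldl_internal_prod_ch: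
  fixes u :: "'i \<Rightarrow> (nat \<Rightarrow> nat) \<Rightarrow> 'a::field_char_0"
  assumes "v \<in> sym_characters d" "\<And>m. m \<in> set ms \<Longrightarrow> u m \<in> sym_characters d"
  shows "foldl (internal_prod d) (ch d v) (map (\<lambda>m. ch d (u m)) ms) =
    ch d (\<lambda>\<sigma>. v \<sigma> * (\<Prod>m\<leftarrow>ms. u m \<sigma>))"
  using assms
proof (induction ms arbitrary: v)
  case (Cons m ms)
  then show ?case
    by (simp add: internal_prod_ch sym_characters_mult mult.assoc)
qed simp

section \<open>Cycle indices as characteristics of induced characters\<close>

text \<open>\<pi> maps the orbits of \<sigma> bijectively to the orbits of the conjugate permutation
  and preserves their sizes.\<close>

lemma cycle_monomial_conj:
  assumes \<pi>: "\<pi> permutes {1..d}" and \<sigma>: "\<sigma> permutes {1..d}"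
  shows "cycle_monomial d (\<pi> \<circ> \<sigma> \<circ> Hilbert_Choice.inv \<pi>) = cycle_monomial d \<sigma>"
proof -
  let ?\<tau> = "\<pi> \<circ> \<sigma> \<circ> Hilbert_Choice.inv \<pi>"
  have \<tau>: "?\<tau> permutes {1..d}"
    using \<pi> \<sigma> by (intro permutes_compose permutes_inv)
  have inj: "inj \<pi>" using \<pi> by (rule permutes_inj)
  have orbit: "\<pi> ` orbit \<sigma> x = orbit ?\<tau> (\<pi> x)" for x
    by (rule orbit_inverse) (use self_in_orbit [OF \<sigma>] in \<open>simp_all add: permutes_inverses(2) [OF \<pi>]\<close>)
  have "orbit ?\<tau> ` {1..d} = orbit ?\<tau> ` \<pi> ` {1..d}" by (simp only: permutes_image [OF \<pi>])
  also have "\<dots> = (\<lambda>C. \<pi> ` C) ` orbit \<sigma> ` {1..d}" by (simp add: image_image orbit)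
  finally have "cycle_monomial d ?\<tau> = (\<Prod>C\<in>(\<lambda>C. \<pi> ` C) ` orbit \<sigma> ` {1..d}. power_sum (card C) :: 'a mseries)"
    by (simp add: cycle_monomial_eq_prod [OF \<tau>])
  also have "\<dots> = (\<Prod>C\<in>orbit \<sigma> ` {1..d}. power_sum (card (\<pi> ` C)))"
    using inj by (subst prod.reindex) (auto intro!: inj_onI simp: inj_image_eq_iff)
  also have "\<dots> = cycle_monomial d \<sigma>"
    using inj by (simp add: cycle_monomial_eq_prod [OF \<sigma>] card_image inj_on_subset [OF inj])
  finally show ?thesis .
qed

section \<open>Induced characters of the symmetric group\<close>

lemma finite_sym_group: "finite (carrier (sym_group d))"
  by (simp add: sym_group_def finite_permutations)

lemma card_sym_group: "card (carrier (sym_group d)) = fact d"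
  using card_permutations [of "{1..d}" d] by (simp add: sym_group_def)

definition induced_sym_character ::
    "nat \<Rightarrow> (nat \<Rightarrow> nat) set \<Rightarrow> ((nat \<Rightarrow> nat) \<Rightarrow> 'a::field) \<Rightarrow> (nat \<Rightarrow> nat) \<Rightarrow> 'a" where
  "induced_sym_character d W \<chi> \<sigma> =
     (if \<sigma> permutes {1..d} then induced_character (sym_group d) W \<chi> \<sigma> else 0)"

lemma induced_sym_character_in_sym_characters:
  fixes \<chi> :: "(nat \<Rightarrow> nat) \<Rightarrow> 'a::field_char_0"
  assumes "finite_group_character (sym_group d) W \<chi>"
  shows "induced_sym_character d W \<chi> \<in> sym_characters d"
proof -
  interpret finite_group_character "sym_group d" W \<chi> by (rule assms)
  obtain T where T: "finite T"
    "\<And>g h s t. g \<in> carrier (sym_group d) \<Longrightarrow> h \<in> carrier (sym_group d) \<Longrightarrow> s \<in> T \<Longrightarrow> t \<in> T \<Longrightarrow>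
       ext (inv\<^bsub>sym_group d\<^esub> s \<otimes>\<^bsub>sym_group d\<^esub> (g \<otimes>\<^bsub>sym_group d\<^esub> h) \<otimes>\<^bsub>sym_group d\<^esub> t) =
       (\<Sum>r\<in>T. ext (inv\<^bsub>sym_group d\<^esub> s \<otimes>\<^bsub>sym_group d\<^esub> g \<otimes>\<^bsub>sym_group d\<^esub> r) *
          ext (inv\<^bsub>sym_group d\<^esub> r \<otimes>\<^bsub>sym_group d\<^esub> h \<otimes>\<^bsub>sym_group d\<^esub> t))"
    "\<And>s t. s \<in> T \<Longrightarrow> t \<in> T \<Longrightarrow>
       ext (inv\<^bsub>sym_group d\<^esub> s \<otimes>\<^bsub>sym_group d\<^esub> \<one>\<^bsub>sym_group d\<^esub> \<otimes>\<^bsub>sym_group d\<^esub> t) = (if s = t then 1 else 0)"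
    "\<And>g. g \<in> carrier (sym_group d) \<Longrightarrow> induced_character (sym_group d) W \<chi> g =
       (\<Sum>t\<in>T. ext (inv\<^bsub>sym_group d\<^esub> t \<otimes>\<^bsub>sym_group d\<^esub> g \<otimes>\<^bsub>sym_group d\<^esub> t))"
    using induced_kernel by blast
  define A where "A \<sigma> s t = ext (inv\<^bsub>sym_group d\<^esub> s \<otimes>\<^bsub>sym_group d\<^esub> \<sigma> \<otimes>\<^bsub>sym_group d\<^esub> t)" for \<sigma> s t
  have "representation_kernel d T A"
  proof (rule representation_kernelI)
    fix s t assume "s \<in> T" "t \<in> T"
    then show "A id s t = (if s = t then 1 else 0)"
      using T(3) by (simp add: A_def sym_group_one)
  next
    fix \<sigma> \<tau> s t assume "\<sigma> permutes {1..d}" "\<tau> permutes {1..d}" "s \<in> T" "t \<in> T"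
    then show "A (\<sigma> \<circ> \<tau>) s t = (\<Sum>k\<in>T. A \<sigma> s k * A \<tau> k t)"
      using T(2) [of \<sigma> \<tau> s t] by (simp add: A_def sym_group_carrier sym_group_mult)
  qed (rule T(1))
  then have "kernel_character d T A \<in> sym_characters d" by (rule kernel_character_in_sym_characters)
  also have "kernel_character d T A = induced_sym_character d W \<chi>"
    using T(4) by (auto simp: kernel_character_def induced_sym_character_def A_def sym_group_carrier)
  finally show ?thesis .
qed

text \<open>For each x in the sum that defines the induced character, substituting the conjugate of
  \<tau> by x for \<sigma> does not change the cycle monomial and leaves the sum over
  \<open>W\<close>. The d! choices of x cancel the factor in \<open>ch\<close>. Comparing single
  coefficients keeps all sums in the field.\<close>

lemma cycle_index_eq_ch:
  fixes \<chi> :: "(nat \<Rightarrow> nat) \<Rightarrow> 'a::field_char_0"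
  assumes "finite_group_character (sym_group d) W \<chi>"
  shows "cycle_index d W \<chi> = ch d (induced_sym_character d W \<chi>)"
proof (rule mseries_eqI)
  fix m
  interpret finite_group_character "sym_group d" W \<chi> by (rule assms)
  let ?S = "carrier (sym_group d)"
  define z where "z \<sigma> = mcoeff (cycle_monomial d \<sigma> :: 'a mseries) m" for \<sigma>
  have conj: "(\<Sum>\<sigma>\<in>?S. ext (inv\<^bsub>sym_group d\<^esub> x \<otimes>\<^bsub>sym_group d\<^esub> \<sigma> \<otimes>\<^bsub>sym_group d\<^esub> x) * z \<sigma>) = (\<Sum>\<sigma>\<in>W. \<chi> \<sigma> * z \<sigma>)"
    if x: "x \<in> ?S" for x
  proof -
    have "(\<Sum>\<sigma>\<in>?S. ext (inv\<^bsub>sym_group d\<^esub> x \<otimes>\<^bsub>sym_group d\<^esub> \<sigma> \<otimes>\<^bsub>sym_group d\<^esub> x) * z \<sigma>) =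
        (\<Sum>\<tau>\<in>?S. ext \<tau> * z (x \<otimes>\<^bsub>sym_group d\<^esub> \<tau> \<otimes>\<^bsub>sym_group d\<^esub> inv\<^bsub>sym_group d\<^esub> x))"
      by (rule sum.reindex_bij_witness [where
            i = "\<lambda>\<tau>. x \<otimes>\<^bsub>sym_group d\<^esub> \<tau> \<otimes>\<^bsub>sym_group d\<^esub> inv\<^bsub>sym_group d\<^esub> x" and
            j = "\<lambda>\<sigma>. inv\<^bsub>sym_group d\<^esub> x \<otimes>\<^bsub>sym_group d\<^esub> \<sigma> \<otimes>\<^bsub>sym_group d\<^esub> x"])
        (use x in \<open>simp_all add: m_assoc del: sym_group_inv_equality\<close>)
    also have "\<dots> = (\<Sum>\<tau>\<in>?S. if \<tau> \<in> W then \<chi> \<tau> * z \<tau> else 0)"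
    proof (rule sum.cong [OF refl])
      fix \<tau> assume "\<tau> \<in> ?S"
      then have "z (x \<otimes>\<^bsub>sym_group d\<^esub> \<tau> \<otimes>\<^bsub>sym_group d\<^esub> inv\<^bsub>sym_group d\<^esub> x) = z \<tau>"
        using x cycle_monomial_conj [of x d \<tau>, where 'a = 'a]
        by (simp add: z_def sym_group_carrier sym_group_mult)
      then show "ext \<tau> * z (x \<otimes>\<^bsub>sym_group d\<^esub> \<tau> \<otimes>\<^bsub>sym_group d\<^esub> inv\<^bsub>sym_group d\<^esub> x) =
          (if \<tau> \<in> W then \<chi> \<tau> * z \<tau> else 0)"
        by (simp add: ext_def)
    qed
    also have "\<dots> = (\<Sum>\<tau>\<in>?S \<inter> W. \<chi> \<tau> * z \<tau>)"
      by (simp add: sum.inter_restrict [OF fin])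
    also have "?S \<inter> W = W" using HG by blast
    finally show ?thesis .
  qed
  have "mcoeff (ch d (induced_sym_character d W \<chi>)) m =
      inverse (of_nat (fact d)) * (\<Sum>\<sigma>\<in>?S. induced_character (sym_group d) W \<chi> \<sigma> * z \<sigma>)"
    by (simp add: ch_def mcoeff_sum z_def induced_sym_character_def sym_group_carrier)
  also have "(\<Sum>\<sigma>\<in>?S. induced_character (sym_group d) W \<chi> \<sigma> * z \<sigma>) = inverse (of_nat (card W)) *
      (\<Sum>\<sigma>\<in>?S. \<Sum>x\<in>?S. ext (inv\<^bsub>sym_group d\<^esub> x \<otimes>\<^bsub>sym_group d\<^esub> \<sigma> \<otimes>\<^bsub>sym_group d\<^esub> x) * z \<sigma>)"
    by (simp add: induced_eq_sum_ext sum_distrib_left sum_distrib_right mult.assoc)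
  also have "(\<Sum>\<sigma>\<in>?S. \<Sum>x\<in>?S. ext (inv\<^bsub>sym_group d\<^esub> x \<otimes>\<^bsub>sym_group d\<^esub> \<sigma> \<otimes>\<^bsub>sym_group d\<^esub> x) * z \<sigma>) =
      of_nat (fact d) * (\<Sum>\<sigma>\<in>W. \<chi> \<sigma> * z \<sigma>)"
  proof -
    have "(\<Sum>x\<in>?S. \<Sum>\<sigma>\<in>?S. ext (inv\<^bsub>sym_group d\<^esub> x \<otimes>\<^bsub>sym_group d\<^esub> \<sigma> \<otimes>\<^bsub>sym_group d\<^esub> x) * z \<sigma>) =
        (\<Sum>x\<in>?S. \<Sum>\<sigma>\<in>W. \<chi> \<sigma> * z \<sigma>)"
      by (intro sum.cong refl conj)
    then show ?thesis
      by (subst sum.swap) (simp add: card_sym_group)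
  qed
  also have "inverse (of_nat (fact d)) * (inverse (of_nat (card W)) * (of_nat (fact d) * (\<Sum>\<sigma>\<in>W. \<chi> \<sigma> * z \<sigma>))) =
      inverse (of_nat (card W)) * (\<Sum>\<sigma>\<in>W. \<chi> \<sigma> * z \<sigma>)"
    by simp
  finally show "mcoeff (cycle_index d W \<chi>) m = mcoeff (ch d (induced_sym_character d W \<chi>)) m"
    by (simp add: cycle_index_def mcoeff_sum z_def)
qed

section \<open>Automorphism groups of graphs with multiple edges\<close>

lemma subgroup_graph_aut: "subgroup (graph_aut d \<Gamma>) (sym_group d)"
proof -
  interpret group "sym_group d" by (rule sym_group_is_group)
  show ?thesis
  proof (rule subgroupI)
    have "id \<in> graph_aut d \<Gamma>" by (simp add: graph_aut_def sym_group_carrier permutes_id)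
    then show "graph_aut d \<Gamma> \<noteq> {}" by blast
  next
    fix \<sigma> assume \<sigma>: "\<sigma> \<in> graph_aut d \<Gamma>"
    then have S: "\<sigma> permutes {1..d}" by (simp add: graph_aut_def sym_group_carrier)
    have "count \<Gamma> (Upair (inv' \<sigma> i) (inv' \<sigma> j)) = count \<Gamma> (Upair i j)"
      if "i \<in> {1..d}" "j \<in> {1..d}" for i j
    proof -
      have "inv' \<sigma> i \<in> {1..d}" "inv' \<sigma> j \<in> {1..d}"
        using that permutes_in_image [OF permutes_inv [OF S]] by blast+
      then have "count \<Gamma> (Upair (\<sigma> (inv' \<sigma> i)) (\<sigma> (inv' \<sigma> j))) = count \<Gamma> (Upair (inv' \<sigma> i) (inv' \<sigma> j))"
        using \<sigma> by (simp add: graph_aut_def)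
      then show ?thesis by (simp add: permutes_inverses(1) [OF S])
    qed
    then show "inv\<^bsub>sym_group d\<^esub> \<sigma> \<in> graph_aut d \<Gamma>"
      using S by (simp add: graph_aut_def sym_group_carrier permutes_inv)
  next
    fix \<sigma> \<tau> assume \<sigma>: "\<sigma> \<in> graph_aut d \<Gamma>" and \<tau>: "\<tau> \<in> graph_aut d \<Gamma>"
    then have S: "\<sigma> permutes {1..d}" "\<tau> permutes {1..d}" by (simp_all add: graph_aut_def sym_group_carrier)
    have "count \<Gamma> (Upair (\<sigma> (\<tau> i)) (\<sigma> (\<tau> j))) = count \<Gamma> (Upair i j)"
      if "i \<in> {1..d}" "j \<in> {1..d}" for i j
    proof -
      have "\<tau> i \<in> {1..d}" "\<tau> j \<in> {1..d}" using that permutes_in_image [OF S(2)] by blast+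
      then show ?thesis using \<sigma> \<tau> that by (simp add: graph_aut_def)
    qed
    then show "\<sigma> \<otimes>\<^bsub>sym_group d\<^esub> \<tau> \<in> graph_aut d \<Gamma>"
      using S by (simp add: graph_aut_def sym_group_carrier sym_group_mult permutes_compose)
  qed (auto simp: graph_aut_def)
qed

section \<open>Characters of dihedral groups\<close>

text \<open>A rotation is a product of two reflections, and reflections are involutions, so \<psi>
  of a rotation has square 1. For odd b every rotation is itself a square of a rotation and gets the
  value 1; then all reflections share one value, which differs from 1 because \<psi> is
  non-trivial.\<close>

lemma dihedral_character:
  fixes \<psi> :: "int \<times> bool \<Rightarrow> 'k::field"
  assumes b: "odd b" and \<psi>: "\<psi> \<in> hom (dihedral_group b) field_units"
    and nontrivial: "\<exists>p\<in>carrier (dihedral_group b). \<psi> p \<noteq> 1"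
    and p: "p \<in> carrier (dihedral_group b)"
  shows "\<psi> p = 1 \<longleftrightarrow> \<not> snd p" "\<psi> p * \<psi> p = 1"
proof -
  have b0: "int b > 0" using b by (cases b) auto
  have mult: "\<psi> ((if e then i - j else i + j) mod int b, e \<noteq> f) = \<psi> (i, e) * \<psi> (j, f)"
    if "i \<in> {0..<int b}" "j \<in> {0..<int b}" for i j e f
    using hom_mult [OF \<psi>, of "(i, e)" "(j, f)"] that by (simp add: dihedral_group_def field_units_def)
  have zero: "0 \<in> {0..<int b}" using b0 by simp
  have "\<psi> (0, False) \<noteq> 0"
    using \<psi> zero by (auto simp: hom_def field_units_def dihedral_group_def)
  then have one: "\<psi> (0, False) = 1"
    using mult [OF zero zero, of False False] by simp
  have rotation: "\<psi> (i, False) = 1" and reflection: "\<psi> (i, True) = \<psi> (0, True)"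
    if i: "i \<in> {0..<int b}" for i
  proof -
    have invol: "\<psi> (j, True) * \<psi> (j, True) = 1" if "j \<in> {0..<int b}" for j
      using mult [OF that that, of True True] one by simp
    have rot: "\<psi> (j, False) = \<psi> (j, True) * \<psi> (0, True)" if "j \<in> {0..<int b}" for j
      using mult [OF that zero, of True True] that by simp
    \<comment> \<open>As \<open>b\<close> is odd, the rotation by \<open>i\<close> is the square of the rotation by \<open>i (b + 1) / 2\<close>.\<close>
    obtain c where c: "int b = 2 * c + 1" using b by (metis even_of_nat oddE)
    define j where "j = (i * (c + 1)) mod int b"
    have j: "j \<in> {0..<int b}" using b0 by (simp add: j_def)
    have "(j + j) mod int b = (i * (c + 1) + i * (c + 1)) mod int b"
      unfolding j_def by (rule mod_add_eq)
    also have "i * (c + 1) + i * (c + 1) = i + i * int b"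
      by (simp add: c algebra_simps)
    also have "(i + i * int b) mod int b = i" using i by simp
    finally have "\<psi> (i, False) = \<psi> (j, False) * \<psi> (j, False)"
      using mult [OF j j, of False False] by simp
    also have "\<dots> = (\<psi> (j, True) * \<psi> (j, True)) * (\<psi> (0, True) * \<psi> (0, True))"
      by (simp add: rot [OF j])
    finally show rotation: "\<psi> (i, False) = 1" using invol j zero by simp
    have "\<psi> (i, True) * \<psi> (0, True) = \<psi> (0, True) * \<psi> (0, True)"
      using rot [OF i] rotation invol [OF zero] by simp
    moreover have "\<psi> (0, True) \<noteq> 0" using invol [OF zero] by auto
    ultimately show "\<psi> (i, True) = \<psi> (0, True)" by simp
  qed
  have carrier: "q \<in> carrier (dihedral_group b) \<longleftrightarrow> fst q \<in> {0..<int b}" for q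
    by (cases q) (simp add: dihedral_group_def)
  obtain q where q: "fst q \<in> {0..<int b}" "\<psi> q \<noteq> 1" using nontrivial carrier by blast
  then have ne: "\<psi> (0, True) \<noteq> 1"
    using rotation [OF q(1)] reflection [OF q(1)] by (cases q; cases "snd q") auto
  have p': "fst p \<in> {0..<int b}" using p carrier by blast
  show "\<psi> p = 1 \<longleftrightarrow> \<not> snd p"
    using rotation [OF p'] reflection [OF p'] ne by (cases p; cases "snd p") auto
  have "\<psi> (0, True) * \<psi> (0, True) = 1"
    using mult [OF zero zero, of True True] one by simp
  then show "\<psi> p * \<psi> p = 1"
    using rotation [OF p'] reflection [OF p'] by (cases p; cases "snd p") auto
qed

text \<open>If \<delta> is trivial on \<open>H\<close>, then \<open>H\<close> lies in the kernel,
  which corresponds to the b rotations, and its order divides the odd number b. Conversely, \<delta>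
  x has square 1 and its power with odd exponent \<open>card H\<close> is 1, hence \<delta> x =
  1.\<close>

lemma dihedral_character_trivial_iff:
  fixes G (structure) and \<delta> :: "'g \<Rightarrow> 'k::field"
  assumes "group G" and iso: "G \<cong> dihedral_group b" and b: "odd b"
    and \<delta>: "\<delta> \<in> hom G field_units" and nontrivial: "\<exists>x\<in>carrier G. \<delta> x \<noteq> 1"
    and H: "subgroup H G"
  shows "(\<forall>x\<in>H. \<delta> x = 1) \<longleftrightarrow> odd (card H)"
proof -
  interpret group G by fact
  obtain \<phi> where \<phi>: "\<phi> \<in> Group.iso G (dihedral_group b)" using iso by (auto simp: is_iso_def)
  define h where "h = inv_into (carrier G) \<phi>"
  have h: "h \<in> Group.iso (dihedral_group b) G" unfolding h_def by (rule iso_set_sym [OF \<phi>])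
  have bij: "bij_betw \<phi> (carrier G) (carrier (dihedral_group b))" using \<phi> by (simp add: Group.iso_def)
  have h\<phi>: "h (\<phi> x) = x" if "x \<in> carrier G" for x
    unfolding h_def using bij that by (simp add: bij_betw_def)
  have \<phi>D: "\<phi> x \<in> carrier (dihedral_group b)" if "x \<in> carrier G" for x
    using bij that by (rule bij_betwE [THEN bspec])
  have hom: "\<delta> \<circ> h \<in> hom (dihedral_group b) field_units"
    using h by (intro Group.hom_compose [OF _ \<delta>]) (simp add: Group.iso_def)
  have nontriv: "\<exists>p\<in>carrier (dihedral_group b). (\<delta> \<circ> h) p \<noteq> 1"
  proof -
    obtain x where "x \<in> carrier G" "\<delta> x \<noteq> 1" using nontrivial by blast
    then show ?thesis using \<phi>D h\<phi> by (intro bexI [of _ "\<phi> x"]) simp_all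
  qed
  have \<delta>_iff: "\<delta> x = 1 \<longleftrightarrow> \<not> snd (\<phi> x)" and invol: "\<delta> x * \<delta> x = 1" if x: "x \<in> carrier G" for x
    using dihedral_character [OF b hom nontriv \<phi>D [OF x]] h\<phi> [OF x] by simp_all
  have HG: "x \<in> carrier G" if "x \<in> H" for x using subgroup.mem_carrier [OF H that] .
  have \<delta>_mult: "\<delta> (x \<otimes> y) = \<delta> x * \<delta> y" if "x \<in> carrier G" "y \<in> carrier G" for x y
    using hom_mult [OF \<delta> that] by (simp add: field_units_def)
  have \<delta>_one: "\<delta> \<one> = 1"
  proof -
    have "\<delta> \<one> \<noteq> 0" using \<delta> by (auto simp: hom_def field_units_def)
    then show ?thesis using \<delta>_mult [of \<one> \<one>] by simp
  qed
  show ?thesis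
  proof
    assume trivial: "\<forall>x\<in>H. \<delta> x = 1"
    define K where "K = {x \<in> carrier G. \<delta> x = 1}"
    have K: "subgroup K G"
    proof (rule subgroupI)
      fix x assume x: "x \<in> K"
      then have "\<delta> x * \<delta> (inv x) = 1" using \<delta>_mult [of x "inv x"] \<delta>_one by (simp add: K_def)
      with x show "inv x \<in> K" by (simp add: K_def)
    next
      fix x y assume "x \<in> K" "y \<in> K"
      then show "x \<otimes> y \<in> K" by (simp add: K_def \<delta>_mult)
    next
      show "K \<noteq> {}" using \<delta>_one one_closed unfolding K_def by blast
    qed (simp add: K_def)
    have "subgroup H (G\<lparr>carrier := K\<rparr>)"
      by (rule subgroup_incl [OF H K]) (use trivial HG in \<open>auto simp: K_def\<close>)
    from group.lagrange [OF subgroup_imp_group [OF K] this]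
    have "card H dvd order (G\<lparr>carrier := K\<rparr>)" by (metis dvd_triv_right)
    then have "card H dvd card K" by (simp add: order_def)
    moreover have "card K = b"
    proof -
      have "\<phi> ` K = {0..<int b} \<times> {False}"
      proof (intro equalityI subsetI)
        fix p assume "p \<in> \<phi> ` K"
        then obtain x where "x \<in> carrier G" "\<delta> x = 1" "p = \<phi> x" by (auto simp: K_def)
        then show "p \<in> {0..<int b} \<times> {False}"
          using \<delta>_iff [of x] \<phi>D [of x] by (auto simp: dihedral_group_def mem_Times_iff)
      next
        fix p assume p: "p \<in> {0..<int b} \<times> {False}"
        then have "p \<in> \<phi> ` carrier G" using bij by (auto simp: bij_betw_def dihedral_group_def)
        then obtain x where "x \<in> carrier G" "p = \<phi> x" by blast
        then show "p \<in> \<phi> ` K" using p \<delta>_iff [of x] by (auto simp: K_def)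
      qed
      moreover have "card (\<phi> ` K) = card K"
        by (rule card_image, rule inj_on_subset [OF bij_betw_imp_inj_on [OF bij]]) (auto simp: K_def)
      ultimately show ?thesis by (simp add: card_cartesian_product)
    qed
    ultimately show "odd (card H)" using b by (metis dvd_trans)
  next
    assume odd: "odd (card H)"
    show "\<forall>x\<in>H. \<delta> x = 1"
    proof
      fix x assume x: "x \<in> H"
      interpret H: group "G\<lparr>carrier := H\<rparr>" by (rule subgroup_imp_group [OF H])
      have power: "\<delta> (x [^] n) = \<delta> x ^ n" for n :: nat
        by (induction n) (use x HG in \<open>simp_all add: \<delta>_one \<delta>_mult mult.commute\<close>)
      have "x [^]\<^bsub>G\<lparr>carrier := H\<rparr>\<^esub> card H = \<one>"
        using H.pow_order_eq_1 [of x] x by (simp add: order_def)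
      then have "x [^] card H = \<one>" by (simp add: nat_pow_consistent [symmetric])
      then have "\<delta> x ^ card H = 1" using power \<delta>_one by metis
      moreover obtain n where "card H = 2 * n + 1" using odd by (rule oddE)
      ultimately show "\<delta> x = 1"
        using invol [OF HG [OF x]] by (simp add: power_mult power2_eq_square)
    qed
  qed
qed

section \<open>Superpositions of graphs with dihedral first automorphism group\<close>

theorem corollary3p2p1:
  fixes d k b :: nat
    and \<Gamma> :: "nat \<Rightarrow> nat uprod multiset"
    and W :: "nat \<Rightarrow> (nat \<Rightarrow> nat) set"
    and \<delta> :: "(nat \<Rightarrow> nat) \<Rightarrow> 'a :: {alg_closed_field, field_char_0}"
  assumes "d \<ge> 1" and "k \<ge> 1"
    and "\<And>m. m \<in> {1..k} \<Longrightarrow> graph_on d (\<Gamma> m)"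
    and "\<And>m. m \<in> {1..k} \<Longrightarrow> W m = graph_aut d (\<Gamma> m)"
    and "odd b"
    and "perm_subgroup d (W 1) \<cong> dihedral_group b"
    and "one_dim_character d (W 1) \<delta>"
    and "\<exists>\<sigma>\<in>W 1. \<delta> \<sigma> \<noteq> 1"
  shows "of_nat (card (odd_superpositions d k W)) =
    N d (foldl (internal_prod d) (cycle_index d (W 1) \<delta>)
           (map (\<lambda>m. cycle_index d (W m) (\<lambda>_. 1)) [2..<Suc k]))"
proof -
  let ?G = "sym_group d"
  \<comment> \<open>With trivial characters beyond index 1, the product character of a placement
    reduces to \<delta> on the conjugate of its automorphism group in \<open>W 1\<close>.\<close>
  define \<chi> :: "nat \<Rightarrow> (nat \<Rightarrow> nat) \<Rightarrow> 'a" where "\<chi> m = (if m = 1 then \<delta> else (\<lambda>_. 1))" for m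
  have sub: "subgroup (W m) ?G" if "m \<in> {1..k}" for m
    using assms(4) [OF that] subgroup_graph_aut by simp
  have character: "finite_group_character ?G (W m) (\<chi> m)" if "m \<in> {1..k}" for m
  proof (intro finite_group_character.intro finite_group_character_axioms.intro)
    show "\<chi> m \<in> hom (perm_subgroup d (W m)) field_units"
      using assms(7) by (simp add: \<chi>_def one_dim_character_def) (simp add: hom_def field_units_def)
  qed (use sub that sym_group_is_group finite_sym_group in simp_all)
  interpret group_superposition ?G "{1..k}" W \<chi>
    by (intro group_superposition.intro group_superposition_axioms.intro sym_group_is_group)
      (use character finite_sym_group in simp_all)
  have one: "1 \<in> {1..k}" using assms(2) by simp
  have tuples: "tuples = placements d k" unfolding tuples_def placements_def ..
  have rel: "rel = placement_rel d k W"
    unfolding rel_def placement_rel_def tuples sym_group_mult ..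
  have perm: "a m permutes {1..d}" if "a \<in> tuples" "m \<in> {1..k}" for a m
    using tuples_closed [OF that] by (simp add: sym_group_carrier)
  have aut: "aut a = placement_aut k W a" if a: "a \<in> tuples" for a
  proof -
    have conj_iff: "inv\<^bsub>?G\<^esub> (a m) \<otimes>\<^bsub>?G\<^esub> g \<otimes>\<^bsub>?G\<^esub> a m \<in> W m \<longleftrightarrow> g \<in> (\<lambda>w. a m \<circ> w \<circ> inv' (a m)) ` W m"
      if g: "g \<in> carrier ?G" and m: "m \<in> {1..k}" for g m
    proof
      assume "inv\<^bsub>?G\<^esub> (a m) \<otimes>\<^bsub>?G\<^esub> g \<otimes>\<^bsub>?G\<^esub> a m \<in> W m"
      then have "inv' (a m) \<circ> g \<circ> a m \<in> W m" using tuples_closed [OF a m] by (simp add: sym_group_mult)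
      moreover have "g = a m \<circ> (inv' (a m) \<circ> g \<circ> a m) \<circ> inv' (a m)"
        by (rule ext) (simp add: permutes_inverses [OF perm [OF a m]])
      ultimately show "g \<in> (\<lambda>w. a m \<circ> w \<circ> inv' (a m)) ` W m" by blast
    next
      assume "g \<in> (\<lambda>w. a m \<circ> w \<circ> inv' (a m)) ` W m"
      then obtain w where w: "w \<in> W m" "g = a m \<circ> w \<circ> inv' (a m)" by blast
      have "inv' (a m) \<circ> g \<circ> a m = w"
        by (rule ext) (simp add: w permutes_inverses [OF perm [OF a m]])
      then show "inv\<^bsub>?G\<^esub> (a m) \<otimes>\<^bsub>?G\<^esub> g \<otimes>\<^bsub>?G\<^esub> a m \<in> W m"
        using w tuples_closed [OF a m] by (simp add: sym_group_mult)
    qed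
    \<comment> \<open>\<open>placement_aut\<close> is an intersection that does not mention S_d,
      whereas \<open>aut\<close> is cut out of S_d. As k is at least 1, the set at index 1 already
      confines the intersection to S_d.\<close>
    have "g \<in> carrier ?G" if g: "g \<in> placement_aut k W a" for g
    proof -
      obtain w where w: "w \<in> W 1" "g = a 1 \<circ> w \<circ> inv' (a 1)"
        using g one unfolding placement_aut_def by blast
      have "w permutes {1..d}" using WG [OF one w(1)] by (simp add: sym_group_carrier)
      then show ?thesis
        unfolding w(2) sym_group_carrier
        by (intro permutes_compose permutes_inv perm [OF a one])
    qed
    then show ?thesis using conj_iff unfolding aut_def placement_aut_def by blast
  qed
  have trivial_iff: "(\<forall>g\<in>aut a. aut_character a g = 1) \<longleftrightarrow> odd (card (placement_aut k W a))"
    if a: "a \<in> tuples" for a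
  proof -
    let ?f = "\<lambda>g. inv\<^bsub>?G\<^esub> (a 1) \<otimes>\<^bsub>?G\<^esub> g \<otimes>\<^bsub>?G\<^esub> a 1"
    have "aut_character a g = \<delta> (?f g)" for g
    proof -
      have "aut_character a g = (\<Prod>m\<in>{1}. \<chi> m (inv\<^bsub>?G\<^esub> (a m) \<otimes>\<^bsub>?G\<^esub> g \<otimes>\<^bsub>?G\<^esub> a m))"
        unfolding aut_character_def by (rule prod.mono_neutral_right) (use one in \<open>auto simp: \<chi>_def\<close>)
      then show ?thesis by (simp add: \<chi>_def)
    qed
    then have "(\<forall>g\<in>aut a. aut_character a g = 1) \<longleftrightarrow> (\<forall>h\<in>?f ` aut a. \<delta> h = 1)" by simp
    also have "\<dots> \<longleftrightarrow> odd (card (?f ` aut a))"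
    proof (rule dihedral_character_trivial_iff)
      show "group (perm_subgroup d (W 1))" by (rule subgroup_imp_group [OF sub [OF one]])
      show "\<delta> \<in> hom (perm_subgroup d (W 1)) field_units" using assms(7) by (simp add: one_dim_character_def)
      show "subgroup (?f ` aut a) (perm_subgroup d (W 1))" by (rule conj_aut_subgroup [OF a one])
    qed (use assms in simp_all)
    finally show ?thesis unfolding conj_aut_subgroup(2) [OF a one] unfolding aut [OF a] .
  qed
  have classes: "{S \<in> tuples // rel. \<exists>a\<in>S. \<forall>g\<in>aut a. aut_character a g = 1} = odd_superpositions d k W"
  proof -
    have "a \<in> tuples" if "S \<in> tuples // rel" "a \<in> S" for S a
      using that Union_quotient [OF equiv_rel] by blast
    then have "{S \<in> tuples // rel. \<exists>a\<in>S. \<forall>g\<in>aut a. aut_character a g = 1} =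
        {S \<in> tuples // rel. \<exists>a\<in>S. odd (card (placement_aut k W a))}"
      using trivial_iff by blast
    then show ?thesis unfolding odd_superpositions_def superpositions_def tuples [symmetric] rel [symmetric] .
  qed
  define u where "u m = induced_sym_character d (W m) (\<chi> m)" for m
  have u: "u m \<in> sym_characters d" "cycle_index d (W m) (\<chi> m) = ch d (u m)" if "m \<in> {1..k}" for m
    unfolding u_def using character [OF that]
    by (rule induced_sym_character_in_sym_characters, rule cycle_index_eq_ch)
  have "map (\<lambda>m. cycle_index d (W m) (\<lambda>_. 1)) [2..<Suc k] = map (\<lambda>m. ch d (u m)) [2..<Suc k]"
  proof (rule map_cong [OF refl])
    fix m assume "m \<in> set [2..<Suc k]"
    then have "m \<in> {1..k}" "m \<noteq> 1" by auto
    then show "cycle_index d (W m) (\<lambda>_. 1) = ch d (u m)" using u(2) [of m] by (simp add: \<chi>_def)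
  qed
  moreover have "cycle_index d (W 1) \<delta> = ch d (u 1)" using u(2) [OF one] by (simp add: \<chi>_def)
  ultimately have "foldl (internal_prod d) (cycle_index d (W 1) \<delta>)
      (map (\<lambda>m. cycle_index d (W m) (\<lambda>_. 1)) [2..<Suc k]) =
      foldl (internal_prod d) (ch d (u 1)) (map (\<lambda>m. ch d (u m)) [2..<Suc k])"
    by (simp only:)
  also have "\<dots> = ch d (\<lambda>\<sigma>. u 1 \<sigma> * (\<Prod>m\<leftarrow>[2..<Suc k]. u m \<sigma>))"
  proof (rule foldl_internal_prod_ch [OF u(1) [OF one]])
    fix m assume "m \<in> set [2..<Suc k]"
    then show "u m \<in> sym_characters d" by (intro u(1)) auto
  qed
  \<comment> \<open>The list starts at 2 and the factor of index 1 is the start value of the fold,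
    so together they give the product over {1..k}; for k = 1 the list is empty.\<close>
  also have "(\<lambda>\<sigma>. u 1 \<sigma> * (\<Prod>m\<leftarrow>[2..<Suc k]. u m \<sigma>)) = (\<lambda>\<sigma>. \<Prod>m\<in>{1..k}. u m \<sigma>)"
  proof
    fix \<sigma>
    have "(\<Prod>m\<leftarrow>[2..<Suc k]. u m \<sigma>) = (\<Prod>m\<in>set [2..<Suc k]. u m \<sigma>)"
      by (rule prod.distinct_set_conv_list [symmetric]) (rule distinct_upt)
    moreover have "{1..k} = insert 1 {2..<Suc k}" using assms(2) by auto
    ultimately show "u 1 \<sigma> * (\<Prod>m\<leftarrow>[2..<Suc k]. u m \<sigma>) = (\<Prod>m\<in>{1..k}. u m \<sigma>)"
      by (simp del: upt_Suc)
  qed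
  \<comment> \<open>\<open>N_ch\<close> produces the mean value over S_d, which is the left side of
    \<open>sum_induced_characters\<close>.\<close>
  also have "N d (ch d (\<lambda>\<sigma>. \<Prod>m\<in>{1..k}. u m \<sigma>)) =
      inverse (of_nat (card (carrier ?G))) *
        (\<Sum>\<sigma>\<in>carrier ?G. \<Prod>m\<in>{1..k}. induced_character ?G (W m) (\<chi> m) \<sigma>)"
    unfolding N_ch card_sym_group by (simp add: u_def induced_sym_character_def sym_group_carrier)
  also have "\<dots> = of_nat (card (odd_superpositions d k W))"
    unfolding sum_induced_characters classes ..
  finally show ?thesis ..
qed

end
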